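(* Let $M$ be a sufficiently large real number, i.e. $M\ge M_0$ for a suitable $M_0$ depending on $n$ and $A$. Let $u$ be a solution to $\mathrm{div}(A\nabla u)=0$ in $B(0,M)\subset\mathbb{R}^n$, where $A\in\mathcal{A}_2$ with constant $\lambda$, and assume that the frequency function of $u$ satisfies $\beta(0,r)\leq N$ for all $0<r<M$. Let $u|_{\partial B(0,1)}=\sum_{m=0}^{\infty}\Phi_m$ be the $L^2(\partial B(0,1))$-expansion of $u|_{\partial B(0,1)}$ with $\Phi_m\in H_m(\partial B(0,1))$, so that $\Phi_m$ is the orthogonal projection of $u|_{\partial B(0,1)}$ onto $H_m(\partial B(0,1))$. Then there exist constants $T$ (an integer) and $C$, depending only on $\lambda,n,N$ and $M$, such that $$\int_{B(0,1/4)}|u|^{2}\leq C\sum_{m=0}^{T}\left<u,\Phi_{m}\right>_{L^{2}(\partial B(0,1))}.$$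
   Context: $B(x,r)=\{y\in\mathbb{R}^n:|x-y|\le r\}$. $\mathcal{A}_2$ (with constant $\lambda>0$) is the set of matrix-valued functions $A=A(x)$ with $C^1$ entries on the domain of the equation such that $\lambda^{-1}|\xi|^2\le \xi^{T}A(x)\xi\le\lambda|\xi|^2$ for all $\xi\in\mathbb{R}^n$ and all $x$, and such that all entries of $A$ have Lipschitz constant smaller than $\lambda$. Frequency function: for a solution $u$, not identically zero, put $\mu(x)=\frac{(A(x)x,x)}{|x|^2}$, $$h(0,r)=r^{1-n}\int_{\partial B(0,r)}\mu|u|^2\,dS,\qquad D(0,r)=r^{1-n}\int_{B(0,r)}(A\nabla u,\nabla u)\,dy,\qquad \beta(0,r)=\frac{rD(0,r)}{h(0,r)}.$$ $H_m(\partial B(0,1))$ is the space of restrictions to $\partial B(0,1)$ of homogeneous harmonic polynomials of degree $m$ on $\mathbb{R}^n$; one has the orthogonal decomposition $L^2(\partial B(0,1))=\bigoplus_{m=0}^\infty H_m(\partial B(0,1))$. $\langle f,g\rangle_{L^2(\partial B(0,1))}=\int_{\partial B(0,1)}fg\,dS$. *)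

theory Defs
  imports "HOL-Analysis.Analysis"
begin

section \<open>Surface measure on spheres\<close>

text \<open>
  The surface measure \<open>dS\<close> on the sphere of radius \<open>r > 0\<close> about the origin, given by polar
  coordinates: a Borel set \<open>E\<close> of the sphere has measure \<open>n / r\<close> times the Lebesgue measure of the
  cone \<open>{t *\<^sub>R x |t x. x \<in> E \<and> 0 < t \<and> t \<le> 1}\<close>. The underlying space of the measure is the sphere
  itself, so functions defined elsewhere are only seen through their restriction to it.
\<close>

definition sphere_measure :: "real \<Rightarrow> 'a::euclidean_space measure" where
  "sphere_measure r =
     scale_measure (ennreal (real DIM('a) / r))
       (distr (restrict_space lborel (cball 0 r - {0}))
              (restrict_space borel (sphere 0 r))
              (\<lambda>x. (r / norm x) *\<^sub>R x))"

lemma space_sphere_measure [simp]: "space (sphere_measure r) = sphere 0 r"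
  by (simp add: sphere_measure_def space_scale_measure space_restrict_space)

lemma sets_sphere_measure [simp, measurable_cong]:
  "sets (sphere_measure r) = sets (restrict_space borel (sphere 0 r))"
  by (simp add: sphere_measure_def)

definition sphere_inner :: "('a::euclidean_space \<Rightarrow> real) \<Rightarrow> ('a \<Rightarrow> real) \<Rightarrow> real" where
  "sphere_inner f g = (LINT x|sphere_measure 1. f x * g x)"


section \<open>Spherical harmonics\<close>

definition laplacian :: "('a::euclidean_space \<Rightarrow> real) \<Rightarrow> 'a \<Rightarrow> real" where
  "laplacian f x = (\<Sum>b\<in>Basis. (deriv ^^ 2) (\<lambda>t. f (x + t *\<^sub>R b)) 0)"

definition homogeneous_harmonic_polynomial ::
    "nat \<Rightarrow> ('a::euclidean_space \<Rightarrow> real) \<Rightarrow> bool" where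
  "homogeneous_harmonic_polynomial m p \<longleftrightarrow>
     real_polynomial_function p \<and>
     (\<forall>c x. p (c *\<^sub>R x) = c ^ m * p x) \<and>
     (\<forall>x. laplacian p x = 0)"

text \<open>Elements of this set are total functions; only their values on the unit sphere matter.\<close>

definition spherical_harmonics :: "nat \<Rightarrow> ('a::euclidean_space \<Rightarrow> real) set" where
  "spherical_harmonics m =
     {f. \<exists>p. homogeneous_harmonic_polynomial m p \<and> (\<forall>x\<in>sphere 0 1. f x = p x)}"

definition spherical_expansion ::
    "('a::euclidean_space \<Rightarrow> real) \<Rightarrow> (nat \<Rightarrow> 'a \<Rightarrow> real) \<Rightarrow> bool" where
  "spherical_expansion u \<Phi> \<longleftrightarrow>
     (\<forall>m. \<Phi> m \<in> spherical_harmonics m) \<and>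
     (\<lambda>k. LINT x|sphere_measure 1. (u x - (\<Sum>m\<le>k. \<Phi> m x))\<^sup>2) \<longlonglongrightarrow> 0"


section \<open>Coefficients\<close>

definition C1_on :: "'a::euclidean_space set \<Rightarrow> ('a \<Rightarrow> real) \<Rightarrow> bool" where
  "C1_on \<Omega> f \<longleftrightarrow> (\<exists>f'. (\<forall>x\<in>\<Omega>. GDERIV f x :> f' x) \<and> continuous_on \<Omega> f')"

text \<open>The class \<open>\<A>\<^sub>2\<close> with constant \<open>lam\<close> on an open set. Symmetry is not required.\<close>

definition coeff_class ::
    "(real ^ 'n) set \<Rightarrow> real \<Rightarrow> (real ^ 'n \<Rightarrow> real ^ 'n ^ 'n) set" where
  "coeff_class \<Omega> lam =
     {A. (\<forall>i j. C1_on \<Omega> (\<lambda>x. A x $ i $ j)) \<and>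
         (\<forall>x\<in>\<Omega>. \<forall>\<xi>. inverse lam * (norm \<xi>)\<^sup>2 \<le> \<xi> \<bullet> (A x *v \<xi>) \<and>
                     \<xi> \<bullet> (A x *v \<xi>) \<le> lam * (norm \<xi>)\<^sup>2) \<and>
         (\<forall>i j. \<exists>L<lam. L-lipschitz_on \<Omega> (\<lambda>x. A x $ i $ j))}"


section \<open>Weak solutions\<close>

text \<open>
  Test functions are \<open>C\<^sup>1\<close> with compact support in \<open>\<Omega>\<close>; the second argument is the gradient
  of the first.
\<close>

definition test_function ::
    "'a::euclidean_space set \<Rightarrow> ('a \<Rightarrow> real) \<Rightarrow> ('a \<Rightarrow> 'a) \<Rightarrow> bool" where
  "test_function \<Omega> \<phi> d\<phi> \<longleftrightarrow>
     (\<forall>x. GDERIV \<phi> x :> d\<phi> x) \<and> continuous_on UNIV d\<phi> \<and>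
     compact (closure {x. \<phi> x \<noteq> 0}) \<and> closure {x. \<phi> x \<noteq> 0} \<subseteq> \<Omega>"

definition L2_loc ::
    "'a::euclidean_space set \<Rightarrow> ('a \<Rightarrow> 'b::euclidean_space) \<Rightarrow> bool" where
  "L2_loc \<Omega> f \<longleftrightarrow>
     set_borel_measurable lebesgue \<Omega> f \<and>
     (\<forall>K. compact K \<longrightarrow> K \<subseteq> \<Omega> \<longrightarrow> set_integrable lebesgue K (\<lambda>x. (norm (f x))\<^sup>2))"

text \<open>\<open>du\<close> is a version of the weak gradient \<open>\<nabla>u\<close>, which is unique up to null sets.\<close>

definition weak_gradient ::
    "'a::euclidean_space set \<Rightarrow> ('a \<Rightarrow> real) \<Rightarrow> ('a \<Rightarrow> 'a) \<Rightarrow> bool" where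
  "weak_gradient \<Omega> u du \<longleftrightarrow>
     (\<forall>\<phi> d\<phi>. test_function \<Omega> \<phi> d\<phi> \<longrightarrow>
        (LINT x:\<Omega>|lebesgue. u x *\<^sub>R d\<phi> x) = - (LINT x:\<Omega>|lebesgue. \<phi> x *\<^sub>R du x))"

text \<open>
  Weak solutions \<open>u\<close> in \<open>W\<^sup>1\<^sup>,\<^sup>2\<^sub>l\<^sub>o\<^sub>c\<close> of \<open>div (A \<nabla>u) = 0\<close>. Every such \<open>u\<close> agrees almost
  everywhere with a continuous function (De Giorgi, Nash, Moser); \<open>u\<close> is taken to be that
  representative, so that it has well-defined restrictions to spheres.
\<close>

definition div_form_solution ::
    "(real ^ 'n) set \<Rightarrow> (real ^ 'n \<Rightarrow> real ^ 'n ^ 'n) \<Rightarrow>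
     (real ^ 'n \<Rightarrow> real) \<Rightarrow> (real ^ 'n \<Rightarrow> real ^ 'n) \<Rightarrow> bool" where
  "div_form_solution \<Omega> A u du \<longleftrightarrow>
     continuous_on \<Omega> u \<and> L2_loc \<Omega> u \<and> L2_loc \<Omega> du \<and> weak_gradient \<Omega> u du \<and>
     (\<forall>\<phi> d\<phi>. test_function \<Omega> \<phi> d\<phi> \<longrightarrow>
        (LINT x:\<Omega>|lebesgue. (A x *v du x) \<bullet> d\<phi> x) = 0)"


section \<open>Frequency function\<close>

definition freq_weight :: "(real ^ 'n \<Rightarrow> real ^ 'n ^ 'n) \<Rightarrow> real ^ 'n \<Rightarrow> real" where
  "freq_weight A x = ((A x *v x) \<bullet> x) / (norm x)\<^sup>2"

definition freq_h ::
    "(real ^ 'n \<Rightarrow> real ^ 'n ^ 'n) \<Rightarrow> (real ^ 'n \<Rightarrow> real) \<Rightarrow> real \<Rightarrow> real" where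
  "freq_h A u r =
     r powi (1 - int CARD('n)) * (LINT x|sphere_measure r. freq_weight A x * \<bar>u x\<bar>\<^sup>2)"

definition freq_D ::
    "(real ^ 'n \<Rightarrow> real ^ 'n ^ 'n) \<Rightarrow> (real ^ 'n \<Rightarrow> real ^ 'n) \<Rightarrow> real \<Rightarrow> real" where
  "freq_D A du r =
     r powi (1 - int CARD('n)) * (LINT y:cball 0 r|lebesgue. (A y *v du y) \<bullet> du y)"

definition frequency ::
    "(real ^ 'n \<Rightarrow> real ^ 'n ^ 'n) \<Rightarrow> (real ^ 'n \<Rightarrow> real) \<Rightarrow>
     (real ^ 'n \<Rightarrow> real ^ 'n) \<Rightarrow> real \<Rightarrow> real" where
  "frequency A u du r = r * freq_D A du r / freq_h A u r"

end

theory Submission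
  imports Defs
begin

text \<open>
  The frequency bound at \<open>r = 1\<close> gives \<open>\<integral>\<^sub>B \<bar>\<nabla>u\<bar>\<^sup>2 \<le> \<bar>N\<bar> \<lambda>\<^sup>2 \<integral>\<^sub>S u\<^sup>2\<close> on the unit ball \<open>B\<close> with
  boundary \<open>S\<close>. For a homogeneous harmonic polynomial
  \<open>q\<close> of degree \<open>m\<close> the divergence theorem gives \<open>m \<integral>\<^sub>S u q = \<integral>\<^sub>B \<nabla>u \<bullet> \<nabla>q\<close>. Hence different degrees
  are orthogonal, and expanding \<open>0 \<le> \<integral>\<^sub>B \<bar>\<nabla>u - \<nabla>P\<bar>\<^sup>2\<close> for a partial sum \<open>P\<close> of the expansion gives
  \<open>\<Sum> m \<parallel>\<Phi>\<^sub>m\<parallel>\<^sup>2 \<le> \<integral>\<^sub>B \<bar>\<nabla>u\<bar>\<^sup>2\<close>. So for large \<open>T\<close> the degrees above \<open>T\<close> carry at most half of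
  \<open>\<integral>\<^sub>S u\<^sup>2\<close>. Finally \<open>\<integral>\<^sub>B u\<^sup>2\<close> is controlled by \<open>\<integral>\<^sub>S u\<^sup>2 + \<integral>\<^sub>B \<bar>\<nabla>u\<bar>\<^sup>2\<close>: for a polynomial \<open>g\<close>, write
  \<open>g = div (w x)\<close> with a polynomial \<open>w\<close>, test the weak gradient of \<open>u\<close> with \<open>w x\<close>, and let \<open>g\<close> tend
  to \<open>u\<close>.
\<close>

section \<open>Polar coordinates\<close>

text \<open>The solution \<open>u\<close> is only continuous with a weak gradient in L^2_loc, while
  the frequency compares its gradient energy with its values on spheres. A weak gradient can be
  tested only with compactly supported C^1 functions, so the ball is replaced by a radial cutoff
  whose gradient concentrates on the sphere; polar coordinates turn this concentration into a
  one-dimensional limit for which the continuity of \<open>u\<close> is enough. The detour through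
  polynomials \<open>g\<close> has the same reason: the field in the divergence theorem has to be
  C^1, and for polynomials the potential \<open>w\<close> is explicit, one division per homogeneous
  part. A second obstacle is the quotient in the frequency: if \<open>u\<close> vanishes on the unit
  sphere, the bound at radius 1 says nothing while the right-hand side of the claim is 0, so
  \<open>u\<close> has to be shown to vanish inside. There the bound at smaller radii
  enters.\<close>

lemma emeasure_lborel_scaleR_vimage:
  fixes A :: "'a::euclidean_space set"
  assumes [measurable]: "A \<in> sets borel" and "c > 0"
  shows "emeasure lborel A = ennreal (c ^ DIM('a)) * emeasure lborel {x. c *\<^sub>R x \<in> A}"
proof -
  have "emeasure lborel A =
      emeasure (density (distr lborel borel (\<lambda>x::'a. 0 + c *\<^sub>R x)) (\<lambda>_. \<bar>c\<bar> ^ DIM('a))) A"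
    using lborel_affine[of c "0::'a"] assms by simp
  also have "\<dots> = ennreal (c ^ DIM('a)) * emeasure lborel ((\<lambda>x. c *\<^sub>R x) -` A \<inter> space lborel)"
    using assms by (subst emeasure_density_const) (auto simp: emeasure_distr)
  finally show ?thesis by (simp add: vimage_def)
qed

text \<open>Here \<open>B\<close> is a set of directions. The origin is removed because it has none;
  with \<open>1 / 0 = 0\<close> it would be judged by whether 0 lies in \<open>B\<close>.\<close>

definition cone_part :: "'a::euclidean_space set \<Rightarrow> real \<Rightarrow> 'a set" where
  "cone_part B b = {x. x \<noteq> 0 \<and> norm x \<le> b \<and> (1 / norm x) *\<^sub>R x \<in> B}"

lemma cone_part_borel [measurable]:
  assumes [measurable]: "B \<in> sets borel"
  shows "cone_part B b \<in> sets borel"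
  unfolding cone_part_def by measurable

lemma emeasure_cone_part:
  fixes B :: "'a::euclidean_space set"
  assumes [measurable]: "B \<in> sets borel" and b: "b > 0"
  shows "emeasure lborel (cone_part B b) = ennreal (b ^ DIM('a)) * emeasure lborel (cone_part B 1)"
proof -
  have "{x. b *\<^sub>R x \<in> cone_part B b} = cone_part B 1"
    using b by (auto simp: cone_part_def field_simps)
  then show ?thesis
    using emeasure_lborel_scaleR_vimage[of "cone_part B b" b] b by simp
qed

lemma sets_borel_sphere_subset:
  assumes "B \<in> sets (restrict_space borel (sphere (0::'a::euclidean_space) r))"
  shows "B \<in> sets borel" "B \<subseteq> sphere 0 r"
  using assms by (auto simp: sets_restrict_space_iff)

lemma measurable_radial_projection [measurable]:
  assumes "r \<ge> 0" and "0 \<notin> X"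
  shows "(\<lambda>x::'a::euclidean_space. (r / norm x) *\<^sub>R x)
     \<in> restrict_space lborel X \<rightarrow>\<^sub>M restrict_space borel (sphere 0 r)"
proof (rule measurable_restrict_space2)
  show "(\<lambda>x. (r / norm x) *\<^sub>R x) \<in> space (restrict_space lborel X) \<rightarrow> sphere 0 r"
    using assms by (auto simp: space_restrict_space)
  have "(\<lambda>x::'a. (r / norm x) *\<^sub>R x) \<in> borel_measurable lborel"
    by measurable
  then show "(\<lambda>x::'a. (r / norm x) *\<^sub>R x) \<in> borel_measurable (restrict_space lborel X)"
    by (rule measurable_restrict_space1)
qed

text \<open>The definition measures the volume of the cone of height r over the directions of
  \<open>B\<close>. Shrinking it to height 1 gives r^n, and the prefactor n/r leaves n
  r^(n-1).\<close>

lemma emeasure_sphere_measure: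
  fixes B :: "'a::euclidean_space set"
  assumes B: "B \<in> sets (restrict_space borel (sphere 0 r))" and r: "r > 0"
  shows "emeasure (sphere_measure r) B
    = ennreal (real DIM('a) * r ^ (DIM('a) - 1)) * emeasure lborel (cone_part ((*\<^sub>R) r -` B) 1)"
proof -
  note Bb = sets_borel_sphere_subset[OF B]
  have B': "(*\<^sub>R) r -` B \<in> sets borel"
    using measurable_sets_borel[of "(*\<^sub>R) r" borel B] Bb by simp
  have eq: "(\<lambda>x. (r / norm x) *\<^sub>R x) -` B \<inter> space (restrict_space lborel (cball 0 r - {0}))
     = cone_part ((*\<^sub>R) r -` B) r"
    by (auto simp: cone_part_def space_restrict_space)
  have "emeasure (distr (restrict_space lborel (cball 0 r - {0})) (restrict_space borel (sphere 0 r))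
           (\<lambda>x::'a. (r / norm x) *\<^sub>R x)) B
      = emeasure (restrict_space lborel (cball 0 r - {0})) (cone_part ((*\<^sub>R) r -` B) r)"
    using r by (subst emeasure_distr[OF measurable_radial_projection B]) (simp_all only: eq, auto)
  also have "\<dots> = emeasure lborel (cone_part ((*\<^sub>R) r -` B) r)"
    by (rule emeasure_restrict_space) (auto simp: cone_part_def)
  also have "\<dots> = ennreal (r ^ DIM('a)) * emeasure lborel (cone_part ((*\<^sub>R) r -` B) 1)"
    by (rule emeasure_cone_part[OF B' r])
  finally have "emeasure (sphere_measure r) B = ennreal (real DIM('a) / r) *
      (ennreal (r ^ DIM('a)) * emeasure lborel (cone_part ((*\<^sub>R) r -` B) 1))"
    by (simp add: sphere_measure_def)
  also have "\<dots> = ennreal (real DIM('a) / r * r ^ DIM('a)) * emeasure lborel (cone_part ((*\<^sub>R) r -` B) 1)"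
    using r by (simp only: mult.assoc[symmetric], subst ennreal_mult) auto
  also have "real DIM('a) / r * r ^ DIM('a) = real DIM('a) * r ^ (DIM('a) - 1)"
    using r power_minus_mult[of "DIM('a)" r] by (simp add: field_simps)
  finally show ?thesis .
qed

lemma finite_measure_sphere_measure:
  assumes "r > 0"
  shows "finite_measure (sphere_measure r :: 'a::euclidean_space measure)"
proof
  let ?S = "sphere (0::'a) r"
  have S: "?S \<in> sets (restrict_space borel (sphere 0 r))"
    by (auto simp: sets_restrict_space_iff)
  have "emeasure lborel (cone_part ((*\<^sub>R) r -` ?S) 1) \<le> emeasure lborel (cball (0::'a) 1)"
    by (rule emeasure_mono) (auto simp: cone_part_def)
  also have "\<dots> < \<infinity>"
    using emeasure_bounded_finite[of "cball (0::'a) 1"] by (simp add: less_top)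
  finally show "emeasure (sphere_measure r) (space (sphere_measure r :: 'a measure)) \<noteq> \<infinity>"
    unfolding space_sphere_measure emeasure_sphere_measure[OF S assms]
    by (simp add: ennreal_mult_eq_top_iff less_top)
qed

text \<open>Both sides see \<open>B\<close> only through the cone over its directions, so a power of
  r is the whole difference. Spheres of all radii are thereby handled on the unit sphere, with the
  radius as a parameter of the integrand.\<close>

lemma sphere_measure_eq_distr:
  assumes r: "r > 0"
  shows "(sphere_measure r :: 'a::euclidean_space measure) =
    density (distr (sphere_measure 1) (restrict_space borel (sphere 0 r)) ((*\<^sub>R) r))
      (\<lambda>_. ennreal (r ^ (DIM('a) - 1)))" (is "_ = ?R")
proof (rule measure_eqI)
  show "sets (sphere_measure r :: 'a measure) = sets ?R" by simp
  fix B :: "'a set" assume "B \<in> sets (sphere_measure r)"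
  then have B: "B \<in> sets (restrict_space borel (sphere 0 r))" by simp
  note Bb = sets_borel_sphere_subset[OF B]
  have m: "(*\<^sub>R) r \<in> sphere_measure 1 \<rightarrow>\<^sub>M restrict_space borel (sphere (0::'a) r)"
  proof (rule measurable_restrict_space2)
    show "(*\<^sub>R) r \<in> space (sphere_measure 1) \<rightarrow> sphere (0::'a) r" using r by auto
    show "(*\<^sub>R) r \<in> borel_measurable (sphere_measure 1 :: 'a measure)"
      by (subst measurable_cong_sets[OF sets_sphere_measure refl])
        (rule measurable_restrict_space1, measurable)
  qed
  have eq: "(*\<^sub>R) r -` B \<inter> space (sphere_measure 1) = (*\<^sub>R) r -` B"
    using Bb(2) r by auto
  have B1: "(*\<^sub>R) r -` B \<in> sets (restrict_space borel (sphere 0 1))"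
    using measurable_sets[OF m B] unfolding eq by simp
  have "emeasure ?R B = ennreal (r ^ (DIM('a) - 1)) * emeasure (sphere_measure 1) ((*\<^sub>R) r -` B)"
    using B unfolding emeasure_distr[OF m B, unfolded eq, symmetric]
    by (subst emeasure_density_const) auto
  then show "emeasure (sphere_measure r) B = emeasure ?R B"
    using r unfolding emeasure_sphere_measure[OF B r] emeasure_sphere_measure[OF B1 zero_less_one]
    by (simp add: ennreal_mult ac_simps vimage_def)
qed

lemma integral_sphere_measure_scale:
  fixes f :: "'a::euclidean_space \<Rightarrow> real"
  assumes r: "r > 0" and f: "f \<in> borel_measurable (restrict_space borel (sphere 0 r))"
  shows "(LINT x|sphere_measure r. f x) = r ^ (DIM('a) - 1) * (LINT x|sphere_measure 1. f (r *\<^sub>R x))"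
proof -
  have m: "(*\<^sub>R) r \<in> sphere_measure 1 \<rightarrow>\<^sub>M restrict_space borel (sphere (0::'a) r)"
  proof (rule measurable_restrict_space2)
    show "(*\<^sub>R) r \<in> space (sphere_measure 1) \<rightarrow> sphere (0::'a) r" using r by auto
    show "(*\<^sub>R) r \<in> borel_measurable (sphere_measure 1 :: 'a measure)"
      by (subst measurable_cong_sets[OF sets_sphere_measure refl])
        (rule measurable_restrict_space1, measurable)
  qed
  let ?M = "distr (sphere_measure 1) (restrict_space borel (sphere (0::'a) r)) ((*\<^sub>R) r)"
  have "(LINT x|sphere_measure r. f x) = (LINT x|?M. r ^ (DIM('a) - 1) *\<^sub>R f x)"
    using r f by (subst sphere_measure_eq_distr[OF r]) (rule integral_density, auto)
  also have "\<dots> = (LINT x|sphere_measure 1. r ^ (DIM('a) - 1) *\<^sub>R f (r *\<^sub>R x))"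
    by (rule integral_distr[OF m]) (use f in measurable)
  finally show ?thesis by simp
qed

section \<open>Lebesgue measure as a product of a radial measure and the unit sphere\<close>

definition radial_measure :: "nat \<Rightarrow> real measure" where
  "radial_measure n = density lborel (\<lambda>s. ennreal (indicator {0<..} s * s ^ (n - 1)))"

lemma sets_radial_measure [simp, measurable_cong]: "sets (radial_measure n) = sets borel"
  by (simp add: radial_measure_def)

lemma space_radial_measure [simp]: "space (radial_measure n) = UNIV"
  by (simp add: radial_measure_def)

lemma emeasure_radial_measure:
  assumes "n > 0"
  shows "emeasure (radial_measure n) {..b} = ennreal ((max 0 b) ^ n / n)"
proof -
  have "emeasure (radial_measure n) {..b}
     = (\<integral>\<^sup>+s. ennreal (indicator {0<..} s * s ^ (n - 1)) * indicator {..b} s \<partial>lborel)"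
    unfolding radial_measure_def by (subst emeasure_density) auto
  also have "\<dots> = (\<integral>\<^sup>+s. ennreal (s ^ (n - 1)) * indicator {0..max 0 b} s \<partial>lborel)"
  proof (rule nn_integral_cong_AE)
    have "AE s in lborel. s \<noteq> (0::real)" by (rule AE_lborel_singleton)
    then show "AE s in lborel. ennreal (indicator {0<..} s * s ^ (n - 1)) * indicator {..b} s
        = ennreal (s ^ (n - 1)) * indicator {0..max 0 b} s"
      by eventually_elim (auto simp: indicator_def)
  qed
  also have "\<dots> = ennreal ((max 0 b) ^ n / n - 0 ^ n / n)"
  proof (rule nn_integral_FTC_Icc)
    show "((\<lambda>s. s ^ n / real n) has_real_derivative x ^ (n - 1)) (at x)" for x
      using assms by (auto intro!: derivative_eq_intros)
  qed auto
  finally show ?thesis using assms by (simp add: zero_power)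
qed

lemma sigma_finite_radial_measure:
  assumes "n > 0"
  shows "sigma_finite_measure (radial_measure n)"
proof
  show "\<exists>A. countable A \<and> A \<subseteq> sets (radial_measure n) \<and> \<Union>A = space (radial_measure n)
          \<and> (\<forall>a\<in>A. emeasure (radial_measure n) a \<noteq> \<infinity>)"
    by (rule exI[of _ "range (\<lambda>i::nat. {..real i})"])
      (auto simp: emeasure_radial_measure[OF assms] intro: real_arch_simple)
qed

definition polar_map :: "'a::euclidean_space \<Rightarrow> real \<times> 'a" where
  "polar_map x = (norm x, (1 / norm x) *\<^sub>R x)"

lemma measurable_polar_map:
  "polar_map \<in> restrict_space lborel (- {0::'a::euclidean_space})
      \<rightarrow>\<^sub>M radial_measure DIM('a) \<Otimes>\<^sub>M sphere_measure 1"
proof -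
  have "norm \<in> borel_measurable (restrict_space lborel (- {0::'a}))"
    by (rule measurable_restrict_space1) measurable
  then have [measurable]: "norm \<in> restrict_space lborel (- {0::'a}) \<rightarrow>\<^sub>M radial_measure DIM('a)"
    by (subst measurable_cong_sets[OF refl sets_radial_measure])
  have [measurable]: "(\<lambda>x. (1 / norm x) *\<^sub>R x)
      \<in> restrict_space lborel (- {0::'a}) \<rightarrow>\<^sub>M sphere_measure 1"
    by (subst measurable_cong_sets[OF refl sets_sphere_measure])
      (rule measurable_radial_projection, auto)
  show ?thesis unfolding polar_map_def by measurable
qed

text \<open>The factor 1/n in the radial mass b^n/n cancels the factor n in the surface measure. For
  b \<le> 0 the cone is empty and the radial mass is 0.\<close>

lemma polar_map_vimage_radial:
  fixes B :: "'a::euclidean_space set"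
  assumes B: "B \<in> sets (restrict_space borel (sphere 0 1))"
  shows "emeasure lborel {x. x \<noteq> 0 \<and> norm x \<le> b \<and> (1 / norm x) *\<^sub>R x \<in> B}
     = emeasure (radial_measure DIM('a)) {..b} * emeasure (sphere_measure 1) B"
proof (cases "b > 0")
  case True
  have "emeasure (radial_measure DIM('a)) {..b} * emeasure (sphere_measure 1) B
      = ennreal (b ^ DIM('a) / DIM('a) * DIM('a)) * emeasure lborel (cone_part B 1)"
    using True by (simp add: emeasure_radial_measure emeasure_sphere_measure[OF B]
        vimage_def ennreal_mult mult.assoc del: times_divide_eq_left)
  also have "\<dots> = emeasure lborel (cone_part B b)"
    using emeasure_cone_part[OF sets_borel_sphere_subset(1)[OF B] True] by simp
  finally show ?thesis by (simp add: cone_part_def)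
next
  case False
  have "{x. x \<noteq> 0 \<and> norm x \<le> b \<and> (1 / norm x) *\<^sub>R x \<in> B} = {}"
    using False by (auto simp: not_less) (meson norm_le_zero_iff order_trans)
  moreover have "max 0 b = 0" using False by simp
  ultimately show ?thesis by (simp only: emeasure_radial_measure DIM_positive) simp
qed

text \<open>For fixed \<open>B\<close> both sides are measures in \<open>A\<close>. They agree on
  the half-lines \<open>{..b}\<close>, an intersection-stable generator of the Borel sets, and are
  finite on an exhausting sequence of them, so they coincide.\<close>

lemma polar_map_rectangle:
  fixes B :: "'a::euclidean_space set"
  assumes A: "A \<in> sets borel" and B: "B \<in> sets (restrict_space borel (sphere 0 1))"
  shows "emeasure (radial_measure DIM('a)) A * emeasure (sphere_measure 1) B
    = emeasure lborel {x. x \<noteq> 0 \<and> norm x \<in> A \<and> (1 / norm x) *\<^sub>R x \<in> B}"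
proof -
  note Bb [measurable] = sets_borel_sphere_subset(1)[OF B]
  define C where "C = {x. x \<noteq> 0 \<and> (1 / norm x) *\<^sub>R x \<in> B}"
  have C [measurable]: "C \<in> sets borel" unfolding C_def by measurable
  define M where "M = distr (restrict_space lborel C) borel norm"
  define N where "N = scale_measure (emeasure (sphere_measure 1) B) (radial_measure DIM('a))"
  have norm_m: "norm \<in> borel_measurable (restrict_space lborel C)"
    by (rule measurable_restrict_space1) measurable
  have M: "emeasure M X = emeasure lborel {x. x \<noteq> 0 \<and> norm x \<in> X \<and> (1 / norm x) *\<^sub>R x \<in> B}"
    if "X \<in> sets borel" for X
  proof -
    have "emeasure M X = emeasure (restrict_space lborel C) (norm -` X \<inter> C)"
      unfolding M_def using that norm_m
      by (subst emeasure_distr) (auto simp: space_restrict_space)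
    also have "\<dots> = emeasure lborel (norm -` X \<inter> C)"
      by (rule emeasure_restrict_space) auto
    also have "norm -` X \<inter> C = {x. x \<noteq> 0 \<and> norm x \<in> X \<and> (1 / norm x) *\<^sub>R x \<in> B}"
      by (auto simp: C_def)
    finally show ?thesis .
  qed
  have Mb: "emeasure M {..b} = emeasure N {..b}" for b
    using polar_map_vimage_radial[OF B, of b] by (simp add: M N_def mult.commute)
  interpret S: finite_measure "sphere_measure 1 :: 'a measure"
    by (rule finite_measure_sphere_measure) simp
  have "M = N"
  proof (rule measure_eqI_generator_eq)
    show "Int_stable (range (\<lambda>a::real. {..a}))"
      by (auto simp: Int_stable_def)
    show "sets M = sigma_sets UNIV (range (\<lambda>a::real. {..a}))"
      "sets N = sigma_sets UNIV (range (\<lambda>a::real. {..a}))"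
      by (auto simp: M_def N_def borel_eq_atMost)
    show "range (\<lambda>i::nat. {..real i}) \<subseteq> range atMost" by auto
    show "(\<Union>i. {..real i}) = UNIV" by (auto intro: real_arch_simple)
    show "emeasure M {..real i} \<noteq> \<infinity>" for i
      unfolding Mb using S.emeasure_finite[of B]
      by (simp add: N_def emeasure_radial_measure ennreal_mult_eq_top_iff)
  qed (auto simp: Mb)
  then show ?thesis using M[OF A] by (simp add: N_def mult.commute)
qed

text \<open>Rectangles determine the product of sigma-finite measures, so their computation
  identifies the whole product and makes Fubini available.\<close>

lemma distr_polar_map:
  "radial_measure DIM('a) \<Otimes>\<^sub>M sphere_measure 1 =
    distr (restrict_space lborel (- {0})) (radial_measure DIM('a) \<Otimes>\<^sub>M sphere_measure 1)
      (polar_map :: 'a::euclidean_space \<Rightarrow> _)" (is "?P = ?D")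
proof (rule pair_measure_eqI)
  show "sigma_finite_measure (radial_measure DIM('a))"
    by (rule sigma_finite_radial_measure) simp
  show "sigma_finite_measure (sphere_measure 1 :: 'a measure)"
    by (rule finite_measure.axioms(1)[OF finite_measure_sphere_measure]) simp
  show "sets ?P = sets ?D" by simp
  fix A and B :: "'a set"
  assume "A \<in> sets (radial_measure DIM('a))" "B \<in> sets (sphere_measure 1)"
  then have A: "A \<in> sets borel" and B: "B \<in> sets (restrict_space borel (sphere 0 1))"
    and AB: "A \<times> B \<in> sets ?P" by auto
  have "emeasure ?D (A \<times> B)
      = emeasure (restrict_space lborel (- {0})) (polar_map -` (A \<times> B) \<inter> - {0})"
    using AB by (subst emeasure_distr[OF measurable_polar_map]) (auto simp: space_restrict_space)
  also have "\<dots> = emeasure lborel (polar_map -` (A \<times> B) \<inter> - {0})"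
    by (rule emeasure_restrict_space) auto
  also have "polar_map -` (A \<times> B) \<inter> - {0} = {x. x \<noteq> 0 \<and> norm x \<in> A \<and> (1 / norm x) *\<^sub>R x \<in> B}"
    by (auto simp: polar_map_def)
  finally show "emeasure (radial_measure DIM('a)) A * emeasure (sphere_measure 1) B
      = emeasure ?D (A \<times> B)"
    using polar_map_rectangle[OF A B] by simp
qed

theorem polar_integral:
  fixes F :: "'a::euclidean_space \<Rightarrow> real"
  assumes F: "integrable lborel F"
  shows "integrable lborel (\<lambda>s. indicator {0<..} s * s ^ (DIM('a) - 1) *
            (LINT w|sphere_measure 1. F (s *\<^sub>R w)))" (is ?int)
    and "(LINT x|lborel. F x) = (LINT s|lborel. indicator {0<..} s * s ^ (DIM('a) - 1) *
            (LINT w|sphere_measure 1. F (s *\<^sub>R w)))" (is ?eq)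
proof -
  let ?R = "radial_measure DIM('a)" and ?S = "sphere_measure 1 :: 'a measure"
  let ?L = "restrict_space lborel (- {0::'a})"
  interpret R: sigma_finite_measure ?R by (rule sigma_finite_radial_measure) simp
  interpret S: finite_measure ?S by (rule finite_measure_sphere_measure) simp
  interpret P: pair_sigma_finite ?R ?S ..
  have [measurable]: "F \<in> borel_measurable borel" using borel_measurable_integrable[OF F] by simp
  define G where "G = (\<lambda>(s, w). F (s *\<^sub>R w))"
  have id: "(\<lambda>x. x) \<in> ?S \<rightarrow>\<^sub>M borel"
    by (subst measurable_cong_sets[OF sets_sphere_measure refl]) (rule measurable_restrict_space1, simp)
  have [measurable]: "snd \<in> ?R \<Otimes>\<^sub>M ?S \<rightarrow>\<^sub>M (borel :: 'a measure)"
    using measurable_compose[OF measurable_snd[of ?R ?S] id] by simp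
  have [measurable]: "fst \<in> ?R \<Otimes>\<^sub>M ?S \<rightarrow>\<^sub>M (borel :: real measure)"
    using measurable_fst[of ?R ?S] by (simp add: measurable_cong_sets[OF refl sets_radial_measure])
  have G [measurable]: "G \<in> borel_measurable (?R \<Otimes>\<^sub>M ?S)"
    unfolding G_def split_beta' by measurable
  have Gp: "G (polar_map x) = F x" if "x \<noteq> 0" for x
    using that by (simp add: G_def polar_map_def)
  \<comment> \<open>Leaving out the origin, which has no direction, changes the integrand only on a
    null set.\<close>
  have ind: "AE x in lborel. indicator (- {0}) x *\<^sub>R G (polar_map x) = F x"
    using AE_lborel_singleton[of 0] by eventually_elim (simp add: Gp)
  have meas: "(\<lambda>x. indicator (- {0::'a}) x *\<^sub>R G (polar_map x)) \<in> borel_measurable lborel"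
  proof -
    have "(\<lambda>x. indicator (- {0::'a}) x *\<^sub>R G (polar_map x)) = (\<lambda>x. indicator (- {0::'a}) x *\<^sub>R F x)"
      using Gp by (intro ext) (auto simp: indicator_def)
    then show ?thesis by simp
  qed
  have intL: "integrable ?L (\<lambda>x. G (polar_map x))"
    using integrable_cong_AE[OF meas _ ind] F by (subst integrable_restrict_space) auto
  have intG: "integrable (?R \<Otimes>\<^sub>M ?S) G"
    using intL by (subst distr_polar_map) (simp add: integrable_distr_eq[OF measurable_polar_map G])
  have "(LINT x|lborel. F x) = (LINT x|?L. G (polar_map x))"
  proof (subst integral_restrict_space)
    show "(LINT x|lborel. F x) = (LINT x|lborel. indicator (- {0}) x *\<^sub>R G (polar_map x))"
      by (rule integral_cong_AE) (use meas ind in \<open>auto elim!: eventually_mono\<close>)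
  qed simp
  also have "\<dots> = integral\<^sup>L (?R \<Otimes>\<^sub>M ?S) G"
    using integral_distr[OF measurable_polar_map G] by (simp only: distr_polar_map[symmetric])
  also have "\<dots> = (LINT s|?R. LINT w|?S. G (s, w))"
    using P.integral_fst'[OF intG] by simp
  finally have e: "(LINT x|lborel. F x) = (LINT s|?R. LINT w|?S. F (s *\<^sub>R w))"
    by (simp add: G_def)
  have i: "integrable ?R (\<lambda>s. LINT w|?S. F (s *\<^sub>R w))"
    using P.integrable_fst'[OF intG] by (simp add: G_def)
  then have mi: "(\<lambda>s. LINT w|?S. F (s *\<^sub>R w)) \<in> borel_measurable lborel"
    by (auto simp: measurable_cong_sets[OF sets_radial_measure refl])
  have nn: "AE s in lborel. 0 \<le> indicator {0<..} s * (s::real) ^ (DIM('a) - 1)"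
    by (intro AE_I2) (simp split: split_indicator)
  have mw: "(\<lambda>s::real. indicator {0<..} s * s ^ (DIM('a) - 1)) \<in> borel_measurable lborel"
    by measurable
  show ?int
    using i integrable_density[OF mi mw nn] by (simp add: radial_measure_def)
  show ?eq
    unfolding e using integral_density[OF mi mw nn] by (simp add: radial_measure_def)
qed

section \<open>Integrability on compact sets\<close>

lemma set_integrable_continuous_compact:
  fixes f :: "'a::euclidean_space \<Rightarrow> 'b::euclidean_space"
  assumes "compact K" "continuous_on K f"
  shows "set_integrable lborel K f" and "set_integrable lebesgue K f"
proof -
  show *: "set_integrable lborel K f"
    unfolding set_integrable_def by (rule borel_integrable_compact[OF assms])
  then show "set_integrable lebesgue K f"
    unfolding set_integrable_def
    by (subst integrable_completion) (auto simp: set_integrable_def dest: borel_measurable_integrable)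
qed

lemma set_lebesgue_integral_eq_lborel:
  fixes f :: "'a::euclidean_space \<Rightarrow> 'b::euclidean_space"
  assumes "A \<in> sets borel" "continuous_on A f"
  shows "(LINT x:A|lebesgue. f x) = (LINT x:A|lborel. f x)"
  unfolding set_lebesgue_integral_def
  using borel_measurable_continuous_on_indicator[OF assms] by (intro integral_completion) simp

text \<open>Uses t \<le> 1 + t^2 and the finite volume of a compact set. The gradient can then be
  paired with bounded continuous factors.\<close>

lemma L2_loc_imp_set_integrable:
  fixes f :: "'a::euclidean_space \<Rightarrow> 'b::euclidean_space"
  assumes f: "L2_loc \<Omega> f" and K: "compact K" "K \<subseteq> \<Omega>"
  shows "set_integrable lebesgue K f"
proof (rule set_integrable_bound)
  have "set_integrable lebesgue K (\<lambda>x. 1 :: real)"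
    using K by (intro set_integrable_continuous_compact) auto
  then show "set_integrable lebesgue K (\<lambda>x. 1 + (norm (f x))\<^sup>2)"
    using f K unfolding L2_loc_def by (intro set_integral_add) auto
  have "K \<in> sets lebesgue"
    using K(1) by (simp add: borel_compact)
  then show "set_borel_measurable lebesgue K f"
    using f K unfolding L2_loc_def by (intro set_borel_measurable_subset[of lebesgue \<Omega> f K]) auto
  have "t \<le> 1 + t\<^sup>2" for t :: real
    using sum_squares_bound[of t 1] zero_le_power2[of t] unfolding power2_eq_square by linarith
  then show "AE x in lebesgue. x \<in> K \<longrightarrow> norm (f x) \<le> norm (1 + (norm (f x))\<^sup>2)"
    by (auto simp: abs_of_nonneg)
qed

text \<open>A bounded measurable factor preserves integrability. The bilinear form is kept general
  to serve inner products, scalar multiples and matrix-vector products alike.\<close>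

lemma set_integrable_bilinear_continuous:
  fixes h :: "'a::euclidean_space \<Rightarrow> 'b::euclidean_space \<Rightarrow> 'c::euclidean_space"
    and g :: "'d::euclidean_space \<Rightarrow> 'a"
  assumes h: "bilinear h" and K: "compact K" and g: "continuous_on K g"
    and f: "set_integrable lebesgue K f"
  shows "set_integrable lebesgue K (\<lambda>x. h (g x) (f x))"
proof (rule absolutely_integrable_bounded_measurable_product[OF h])
  have cl: "K \<in> sets borel" using K by (simp add: borel_compact)
  have "g \<in> borel_measurable (restrict_space borel K)"
    by (rule borel_measurable_continuous_on_restrict[OF g])
  then have "(\<lambda>x. indicator K x *\<^sub>R g x) \<in> borel_measurable lebesgue"
    using borel_measurable_continuous_on_indicator[OF cl g] by (intro measurable_completion) simp
  then show "g \<in> borel_measurable (lebesgue_on K)"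
    using cl by (subst borel_measurable_restrict_space_iff) auto
  show "K \<in> sets lebesgue" using cl by simp
  show "bounded (g ` K)" using K g by (simp add: compact_continuous_image compact_imp_bounded)
qed fact

lemma bilinear_inner: "bilinear ((\<bullet>) :: 'a::euclidean_space \<Rightarrow> _)"
  by (simp add: bilinear_def linear_iff inner_add_left inner_add_right)

lemma bilinear_scaleR: "bilinear ((*\<^sub>R) :: real \<Rightarrow> 'a::euclidean_space \<Rightarrow> _)"
  by (simp add: bilinear_def linear_iff scaleR_add_left scaleR_add_right)


section \<open>A smooth radial cutoff\<close>

text \<open>The square makes the positive part C^1 across 0, which is the regularity a test function
  needs. The profile is 0 for t \<le> 0 and increases to 1, so
  \<open>cut (k * (r\<^sup>2 - (norm x)\<^sup>2))\<close> lives on the closed ball of radius r and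
  tends to the indicator of the open ball as k grows. The squared norm avoids the singularity of the
  norm at the origin.\<close>

definition cut :: "real \<Rightarrow> real" where
  "cut t = (max 0 t)\<^sup>2 / (1 + (max 0 t)\<^sup>2)"

definition cut' :: "real \<Rightarrow> real" where
  "cut' t = 2 * max 0 t / (1 + (max 0 t)\<^sup>2)\<^sup>2"

lemma one_plus_square_pos: "1 + (x::real)\<^sup>2 > 0" "1 + (x::real)\<^sup>2 \<noteq> 0"
  by (smt (verit) zero_le_power2)+

lemma DERIV_max_0_square: "((\<lambda>t::real. (max 0 t)\<^sup>2) has_real_derivative 2 * max 0 t) (at t)"
proof -
  consider "t < 0" | "t > 0" | "t = 0" by linarith
  then show ?thesis
  proof cases
    case 1
    have "((\<lambda>t::real. 0) has_real_derivative 2 * max 0 t) (at t)" using 1 by simp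
    then show ?thesis
      by (rule has_field_derivative_transform_within_open[of _ _ _ "{..<0}"]) (use 1 in auto)
  next
    case 2
    have "((\<lambda>t::real. t\<^sup>2) has_real_derivative 2 * max 0 t) (at t)"
      using 2 by (auto intro!: derivative_eq_intros)
    then show ?thesis
      by (rule has_field_derivative_transform_within_open[of _ _ _ "{0<..}"]) (use 2 in auto)
  next
    case 3
    have "((\<lambda>h::real. max 0 h) \<longlongrightarrow> max 0 0) (at 0)"
      by (intro tendsto_intros)
    moreover have "(\<lambda>h::real. (max 0 h)\<^sup>2 / h) = (\<lambda>h. max 0 h)"
      by (auto simp: fun_eq_iff max_def power2_eq_square)
    ultimately show ?thesis using 3 by (simp add: DERIV_def)
  qed
qed

lemma DERIV_cut: "(cut has_real_derivative cut' t) (at t)"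
  unfolding cut_def[abs_def] cut'_def
  by (rule derivative_eq_intros DERIV_max_0_square one_plus_square_pos refl)+
    (simp add: field_simps power2_eq_square)

lemma cut_nonpos [simp]: "t \<le> 0 \<Longrightarrow> cut t = 0" "t \<le> 0 \<Longrightarrow> cut' t = 0"
  by (auto simp: cut_def cut'_def max_def)

lemma cut'_nonneg: "cut' t \<ge> 0"
  by (auto simp: cut'_def)

lemma cut_bounds: "0 \<le> cut t" "cut t \<le> 1"
  using one_plus_square_pos[of "max 0 t"] by (auto simp: cut_def divide_simps)

lemma continuous_on_cut' [continuous_intros]:
  "continuous_on A f \<Longrightarrow> continuous_on A (\<lambda>x. cut' (f x))"
  unfolding cut'_def by (intro continuous_intros) (simp_all add: one_plus_square_pos)

lemma continuous_on_cut [continuous_intros]: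
  "continuous_on A f \<Longrightarrow> continuous_on A (\<lambda>x. cut (f x))"
  unfolding cut_def by (intro continuous_intros) (simp_all add: one_plus_square_pos)

lemma tendsto_cut:
  assumes "a > 0"
  shows "(\<lambda>k. cut (real k * a)) \<longlonglongrightarrow> 1"
proof -
  have "(\<lambda>k. 1 - inverse (1 + (real k * a)\<^sup>2)) \<longlonglongrightarrow> 1 - 0"
  proof (intro tendsto_intros tendsto_inverse_0_at_top)
    have "filterlim (\<lambda>k. real k * a) at_top sequentially"
      by (rule filterlim_at_top_mult_tendsto_pos[where c=a])
        (use assms in \<open>auto intro: filterlim_real_sequentially\<close>)
    then have "filterlim (\<lambda>k. (real k * a)\<^sup>2) at_top sequentially"
      by (intro filterlim_pow_at_top) auto
    then show "filterlim (\<lambda>k. 1 + (real k * a)\<^sup>2) at_top sequentially"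
      by (intro filterlim_tendsto_add_at_top[OF tendsto_const])
  qed
  moreover have "1 - inverse (1 + (real k * a)\<^sup>2) = cut (real k * a)" for k
    using assms one_plus_square_pos[of "real k * a"] by (simp add: cut_def max_def field_simps)
  ultimately show ?thesis by simp
qed

text \<open>The weight multiplying \<open>H\<close> is the derivative in s of
  \<open>- cut (real k * (r\<^sup>2 - s\<^sup>2))\<close>. It is nonnegative, its total mass
  \<open>cut (real k * r\<^sup>2)\<close> tends to 1, and its mass gathers near the endpoint: an
  approximate identity at r.\<close>

lemma cut_concentrates:
  fixes H :: "real \<Rightarrow> real"
  assumes H: "continuous_on {0..r} H" and r: "r > 0"
  shows "(\<lambda>k. integral {0..r} (\<lambda>s. 2 * real k * s * cut' (real k * (r\<^sup>2 - s\<^sup>2)) * H s)) \<longlonglongrightarrow> H r"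
proof -
  define w where "w k s = 2 * real k * s * cut' (real k * (r\<^sup>2 - s\<^sup>2))" for k :: nat and s
  define W where "W k s = - cut (real k * (r\<^sup>2 - s\<^sup>2))" for k :: nat and s
  have W: "(W k has_real_derivative w k s) (at s)" for k s
    unfolding W_def[abs_def] w_def
    by (rule derivative_eq_intros DERIV_chain2[OF DERIV_cut] refl)+ simp
  have w_cont: "continuous_on A (w k)" for k A
    unfolding w_def[abs_def] by (intro continuous_intros)
  have w_nonneg: "w k s \<ge> 0" if "s \<ge> 0" for k s
    using that cut'_nonneg by (simp add: w_def)
  have w_int: "(w k has_integral W k b - W k a) {a..b}" if "a \<le> b" for k a b
    by (rule fundamental_theorem_of_calculus[OF that])
      (metis W has_real_derivative_iff_has_vector_derivative has_vector_derivative_at_within)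
  have Wr: "W k r = 0" for k by (simp add: W_def)
  obtain B where B: "\<And>s. s \<in> {0..r} \<Longrightarrow> \<bar>H s\<bar> \<le> B" and B0: "B > 0"
  proof -
    have "bounded (H ` {0..r})" using H compact_continuous_image compact_imp_bounded by blast
    then obtain b where "b > 0" "\<forall>x\<in>{0..r}. \<bar>H x\<bar> \<le> b" unfolding bounded_pos by auto
    then show ?thesis using that[of b] by auto
  qed
  have "\<forall>\<^sub>F k in sequentially. \<bar>integral {0..r} (\<lambda>s. w k s * H s) - H r\<bar> < e" if e: "e > 0" for e
  proof -
    obtain d' where d': "d' > 0" "\<And>s. s \<in> {0..r} \<Longrightarrow> dist s r < d' \<Longrightarrow> dist (H s) (H r) < e / 2"
      using H r e unfolding continuous_on_iff by (metis half_gt_zero atLeastAtMost_iff order_refl less_imp_le)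
    \<comment> \<open>Halving puts r - d strictly between 0 and r, so [0, r] splits there, while
      [r - d, r] stays within distance d' of r.\<close>
    define d where "d = min d' r / 2"
    have d: "0 < d" "d < d'" "d < r" using d' r by (auto simp: d_def min_def)
    \<comment> \<open>Three errors: the variation of \<open>H\<close> near r, the weight left on
      [0, r - d], where \<open>H\<close> differs from \<open>H r\<close> by at most 2 B, and the
      mass still missing from 1.\<close>
    have main: "\<bar>integral {0..r} (\<lambda>s. w k s * H s) - H r\<bar>
        \<le> e / 2 + 2 * B * (1 - cut (real k * (r\<^sup>2 - (r - d)\<^sup>2))) + B * (1 - cut (real k * r\<^sup>2))" for k
    proof -
      define f where "f s = w k s * (H s - H r)" for s
      have wH: "(\<lambda>s. w k s * H s) integrable_on {0..r}"
        by (intro integrable_continuous_interval continuous_intros w_cont H)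
      have wI: "w k integrable_on {0..r}" using w_int[of 0 r k] r by auto
      have f_cont: "continuous_on {0..r} f"
        unfolding f_def by (intro continuous_intros w_cont H)
      have fint: "f integrable_on {a..b}" if "0 \<le> a" "b \<le> r" for a b
        by (rule integrable_continuous_interval) (use f_cont that in \<open>auto intro: continuous_on_subset\<close>)
      have eq: "integral {0..r} (\<lambda>s. w k s * H s) = integral {0..r} f + H r * cut (real k * r\<^sup>2)"
      proof -
        have "integral {0..r} f = integral {0..r} (\<lambda>s. w k s * H s) - integral {0..r} (\<lambda>s. w k s * H r)"
          unfolding f_def right_diff_distrib
          by (rule integral_diff[OF wH]) (use wI in \<open>auto intro: integrable_on_mult_left\<close>)
        also have "integral {0..r} (\<lambda>s. w k s * H r) = cut (real k * r\<^sup>2) * H r"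
          using w_int[of 0 r k] r by (simp add: integral_unique W_def)
        finally show ?thesis by simp
      qed
      have 1: "\<bar>integral {0..r - d} f\<bar> \<le> 2 * B * (1 - cut (real k * (r\<^sup>2 - (r - d)\<^sup>2)))"
      proof -
        have "norm (integral {0..r - d} f) \<le> integral {0..r - d} (\<lambda>s. w k s * (2 * B))"
        proof (rule integral_norm_bound_integral)
          show "f integrable_on {0..r - d}" using d by (intro fint) auto
          show "(\<lambda>s. w k s * (2 * B)) integrable_on {0..r - d}"
            by (intro integrable_continuous_interval continuous_intros w_cont)
          fix s assume s: "s \<in> {0..r - d}"
          have "\<bar>H s - H r\<bar> \<le> 2 * B" using B[of s] B[of r] s d r by auto
          then show "norm (f s) \<le> w k s * (2 * B)"
            using w_nonneg[of s k] s by (simp add: f_def abs_mult mult_left_mono)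
        qed
        also have "\<dots> = (W k (r - d) - W k 0) * (2 * B)"
          using w_int[of 0 "r - d" k] d by (simp add: integral_unique)
        also have "\<dots> \<le> 2 * B * (1 - cut (real k * (r\<^sup>2 - (r - d)\<^sup>2)))"
          using B0 cut_bounds(2)[of "real k * r\<^sup>2"] by (simp add: W_def mult.commute)
        finally show ?thesis by simp
      qed
      have 2: "\<bar>integral {r - d..r} f\<bar> \<le> e / 2"
      proof -
        have "norm (integral {r - d..r} f) \<le> integral {r - d..r} (\<lambda>s. w k s * (e / 2))"
        proof (rule integral_norm_bound_integral)
          show "f integrable_on {r - d..r}" using d by (intro fint) auto
          show "(\<lambda>s. w k s * (e / 2)) integrable_on {r - d..r}"
            by (intro integrable_continuous_interval continuous_intros w_cont) auto
          fix s assume s: "s \<in> {r - d..r}"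
          have "\<bar>H s - H r\<bar> \<le> e / 2" using d'(2)[of s] s d by (auto simp: dist_real_def)
          then show "norm (f s) \<le> w k s * (e / 2)"
            using w_nonneg[of s k] s d by (simp add: f_def abs_mult mult_left_mono del: times_divide_eq_right)
        qed
        also have "\<dots> = (W k r - W k (r - d)) * (e / 2)"
          using w_int[of "r - d" r k] d by (simp add: integral_unique)
        also have "\<dots> \<le> 1 * (e / 2)"
          using e cut_bounds(2)[of "real k * (r\<^sup>2 - (r - d)\<^sup>2)"]
          by (intro mult_right_mono) (simp_all add: W_def)
        finally show ?thesis by simp
      qed
      have "integral {0..r - d} f + integral {r - d..r} f = integral {0..r} f"
        using d by (intro Henstock_Kurzweil_Integration.integral_combine fint) auto
      then have "\<bar>integral {0..r} f\<bar> \<le> e / 2 + 2 * B * (1 - cut (real k * (r\<^sup>2 - (r - d)\<^sup>2)))"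
        using 1 2 by linarith
      moreover have "\<bar>H r * cut (real k * r\<^sup>2) - H r\<bar> \<le> B * (1 - cut (real k * r\<^sup>2))"
      proof -
        have "H r * cut (real k * r\<^sup>2) - H r = - (H r * (1 - cut (real k * r\<^sup>2)))"
          by (simp add: algebra_simps)
        then have "\<bar>H r * cut (real k * r\<^sup>2) - H r\<bar> = \<bar>H r\<bar> * (1 - cut (real k * r\<^sup>2))"
          using cut_bounds(2)[of "real k * r\<^sup>2"] by (simp add: abs_mult)
        also have "\<dots> \<le> B * (1 - cut (real k * r\<^sup>2))"
          using B[of r] r cut_bounds(2)[of "real k * r\<^sup>2"] by (intro mult_right_mono) auto
        finally show ?thesis .
      qed
      ultimately show ?thesis unfolding eq by linarith
    qed
    have "r\<^sup>2 - (r - d)\<^sup>2 > 0" using d by (simp add: power_strict_mono)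
    then have "(\<lambda>k. e / 2 + 2 * B * (1 - cut (real k * (r\<^sup>2 - (r - d)\<^sup>2))) + B * (1 - cut (real k * r\<^sup>2)))
        \<longlonglongrightarrow> e / 2 + 2 * B * (1 - 1) + B * (1 - 1)"
      using r by (intro tendsto_intros tendsto_cut) auto
    moreover have "e / 2 + 2 * B * (1 - 1) + B * (1 - 1) < e" using e by simp
    ultimately have "\<forall>\<^sub>F k in sequentially.
       e / 2 + 2 * B * (1 - cut (real k * (r\<^sup>2 - (r - d)\<^sup>2))) + B * (1 - cut (real k * r\<^sup>2)) < e"
      by (rule order_tendstoD(2))
    then show ?thesis by eventually_elim (rule le_less_trans[OF main])
  qed
  then have "(\<lambda>k. integral {0..r} (\<lambda>s. w k s * H s)) \<longlonglongrightarrow> H r"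
    unfolding tendsto_iff dist_real_def by blast
  then show ?thesis by (simp add: w_def)
qed

section \<open>The divergence theorem on balls\<close>

lemma borel_measurable_sphere_measure:
  fixes f :: "'a::euclidean_space \<Rightarrow> 'b::euclidean_space"
  assumes "continuous_on (sphere 0 r) f"
  shows "f \<in> borel_measurable (sphere_measure r)"
  by (subst measurable_cong_sets[OF sets_sphere_measure refl])
    (rule borel_measurable_continuous_on_restrict[OF assms])

lemma integrable_sphere_measure:
  fixes f :: "'a::euclidean_space \<Rightarrow> real"
  assumes "r > 0" and f: "continuous_on (sphere 0 r) f"
  shows "integrable (sphere_measure r) f"
proof -
  interpret finite_measure "sphere_measure r :: 'a measure"
    by (rule finite_measure_sphere_measure) fact
  have "bounded (f ` sphere 0 r)"
    using f by (simp add: compact_continuous_image compact_imp_bounded)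
  then obtain B where "\<forall>x\<in>sphere 0 r. norm (f x) \<le> B"
    unfolding bounded_iff by auto
  then show ?thesis
    by (intro integrable_const_bound[where B = B] borel_measurable_sphere_measure[OF f] AE_I2) auto
qed

text \<open>Dominated convergence along sequences of parameters: the integrand is bounded on the
  compact product, and the sphere has finite measure.\<close>

lemma continuous_on_sphere_integral:
  fixes F :: "real \<Rightarrow> 'a::euclidean_space \<Rightarrow> real"
  assumes F: "continuous_on ({a..b} \<times> sphere 0 1) (\<lambda>(s, w). F s w)"
  shows "continuous_on {a..b} (\<lambda>s. LINT w|sphere_measure 1. F s w)"
proof (rule continuous_on_sequentiallyI)
  interpret finite_measure "sphere_measure 1 :: 'a measure"
    by (rule finite_measure_sphere_measure) simp
  have "bounded ((\<lambda>(s, w). F s w) ` ({a..b} \<times> sphere 0 1))"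
    by (intro compact_imp_bounded compact_continuous_image[OF F] compact_Times) auto
  then obtain B where "\<forall>p\<in>{a..b} \<times> sphere 0 1. norm (case p of (s, w) \<Rightarrow> F s w) \<le> B"
    unfolding bounded_iff by blast
  then have B: "\<And>s w. s \<in> {a..b} \<Longrightarrow> w \<in> sphere 0 1 \<Longrightarrow> norm (F s w) \<le> B"
    by force
  have F': "continuous_on ({a..b} \<times> sphere 0 1) (\<lambda>p. F (fst p) (snd p))"
    using F by (simp add: split_beta')
  have Fs: "continuous_on (sphere 0 1) (F s)" if "s \<in> {a..b}" for s
    using continuous_on_compose2[OF F', of "sphere 0 1" "\<lambda>w. (s, w)"] that
    by (force intro!: continuous_intros)
  fix x :: "nat \<Rightarrow> real" and s assume x: "\<forall>n. x n \<in> {a..b}" "s \<in> {a..b}" "x \<longlonglongrightarrow> s"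
  show "(\<lambda>n. LINT w|sphere_measure 1. F (x n) w) \<longlonglongrightarrow> (LINT w|sphere_measure 1. F s w)"
  proof (rule integral_dominated_convergence[where w = "\<lambda>_. B"])
    show "AE w in sphere_measure 1. (\<lambda>n. F (x n) w) \<longlonglongrightarrow> F s w"
    proof (rule AE_I2)
      fix w :: 'a assume w: "w \<in> space (sphere_measure 1)"
      have "continuous_on {a..b} (\<lambda>s. F s w)"
        using continuous_on_compose2[OF F', of "{a..b}" "\<lambda>s. (s, w)"] w
        by (force intro!: continuous_intros)
      then show "(\<lambda>n. F (x n) w) \<longlonglongrightarrow> F s w"
        using x unfolding continuous_on_sequentially by (auto simp: o_def)
    qed
    show "AE w in sphere_measure 1. norm (F (x n) w) \<le> B" for n
      using x B by (intro AE_I2) auto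
  qed (use x Fs in \<open>auto intro!: borel_measurable_sphere_measure\<close>)
qed

section \<open>Testing the weak gradient with a cut-off vector field\<close>

lemma set_integral_support:
  assumes "K \<subseteq> \<Omega>" "\<And>x. x \<in> \<Omega> - K \<Longrightarrow> g x = 0"
  shows "(LINT x:\<Omega>|M. g x) = (LINT x:K|M. g x)"
  unfolding set_lebesgue_integral_def
  using assms by (intro Bochner_Integration.integral_cong) (auto simp: indicator_def)

lemma set_integral_inner_left:
  assumes "set_integrable M K f"
  shows "(LINT x:K|M. f x \<bullet> c) = (LINT x:K|M. f x) \<bullet> c"
    and "set_integrable M K (\<lambda>x. f x \<bullet> c)"
proof -
  have *: "(\<lambda>x. indicator K x *\<^sub>R (f x \<bullet> c)) = (\<lambda>x. (indicator K x *\<^sub>R f x) \<bullet> c)"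
    by simp
  show "(LINT x:K|M. f x \<bullet> c) = (LINT x:K|M. f x) \<bullet> c"
    and "set_integrable M K (\<lambda>x. f x \<bullet> c)"
    using assms unfolding set_lebesgue_integral_def set_integrable_def *
    by (rule integral_inner_left, rule integrable_inner_left)
qed

text \<open>The cutoff confines a C^1 function to the closed ball of radius r, which lies in the
  domain since r < M. The radial second term of the gradient is the one that later produces the
  boundary flux.\<close>

lemma test_function_cut:
  fixes f :: "'a::euclidean_space \<Rightarrow> real"
  assumes r: "0 < r" "r < M" and f: "\<And>x. GDERIV f x :> df x" and df: "continuous_on UNIV df"
    and k: "k \<ge> 0"
  shows "test_function (ball 0 M) (\<lambda>x. cut (k * (r\<^sup>2 - (norm x)\<^sup>2)) * f x)
    (\<lambda>x. cut (k * (r\<^sup>2 - (norm x)\<^sup>2)) *\<^sub>R df x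
        + f x *\<^sub>R (cut' (k * (r\<^sup>2 - (norm x)\<^sup>2)) *\<^sub>R ((-2 * k) *\<^sub>R x)))" (is "test_function _ ?\<phi> ?d")
  unfolding test_function_def
proof (intro conjI allI)
  have q: "GDERIV (\<lambda>x. k * (r\<^sup>2 - (norm x)\<^sup>2)) x :> (-2 * k) *\<^sub>R x" for x :: 'a
    unfolding gderiv_def power2_norm_eq_inner
    by (rule derivative_eq_intros refl)+ (auto simp: fun_eq_iff inner_commute algebra_simps)
  show "GDERIV ?\<phi> x :> ?d x" for x
    by (rule GDERIV_mult[OF GDERIV_DERIV_compose[OF q DERIV_cut] f])
  have fc: "continuous_on UNIV f"
    using f has_derivative_continuous unfolding gderiv_def
    by (intro continuous_at_imp_continuous_on) blast
  show "continuous_on UNIV ?d"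
    by (intro continuous_intros df fc)
  have sub: "{x. ?\<phi> x \<noteq> 0} \<subseteq> cball 0 r"
  proof
    fix x assume "x \<in> {x. ?\<phi> x \<noteq> 0}"
    then have "\<not> k * (r\<^sup>2 - (norm x)\<^sup>2) \<le> 0" by auto
    then have "(norm x)\<^sup>2 < r\<^sup>2" using k by (auto simp: mult_le_0_iff)
    then show "x \<in> cball 0 r" using r by (simp add: power_less_imp_less_base less_imp_le)
  qed
  then have "bounded {x. ?\<phi> x \<noteq> 0}" using bounded_subset by blast
  then show "compact (closure {x. ?\<phi> x \<noteq> 0})" by simp
  have "closure {x. ?\<phi> x \<noteq> 0} \<subseteq> cball 0 r" by (intro closure_minimal sub) simp
  also have "\<dots> \<subseteq> ball 0 M" using r by auto
  finally show "closure {x. ?\<phi> x \<noteq> 0} \<subseteq> ball 0 M" .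
qed

text \<open>Testing with the cutoff times \<open>V x \<bullet> b\<close>, reading off the component
  along b and summing over the basis turns the vector-valued weak identity into an integration by
  parts for the field \<open>V\<close>. The gradient of the cutoff is radial, so it meets
  \<open>V\<close> only in \<open>V x \<bullet> x\<close>; this term goes to the right as a smeared
  boundary integral.\<close>

lemma divergence_cut:
  fixes u :: "'a::euclidean_space \<Rightarrow> real" and V :: "'a \<Rightarrow> 'a"
  assumes u: "continuous_on (ball 0 M) u" and du: "L2_loc (ball 0 M) du"
    and weak: "weak_gradient (ball 0 M) u du"
    and r: "0 < r" "r < M" and k: "k \<ge> 0"
    and V: "\<And>b x. b \<in> Basis \<Longrightarrow> GDERIV (\<lambda>x. V x \<bullet> b) x :> dV b x"
    and dV: "\<And>b. b \<in> Basis \<Longrightarrow> continuous_on UNIV (dV b)"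
  defines "c \<equiv> \<lambda>x. cut (k * (r\<^sup>2 - (norm x)\<^sup>2))"
  shows "(LINT x:cball 0 r|lebesgue. c x * (u x * (\<Sum>b\<in>Basis. dV b x \<bullet> b) + V x \<bullet> du x))
    = (LINT x:cball 0 r|lebesgue. u x * (2 * k * cut' (k * (r\<^sup>2 - (norm x)\<^sup>2))) * (V x \<bullet> x))"
    and "set_integrable lebesgue (cball 0 r) (\<lambda>x. u x * (\<Sum>b\<in>Basis. dV b x \<bullet> b) + V x \<bullet> du x)"
proof -
  let ?K = "cball (0::'a) r" and ?\<Omega> = "ball (0::'a) M"
  define d where "d x = cut' (k * (r\<^sup>2 - (norm x)\<^sup>2))" for x :: 'a
  have K: "compact ?K" "?K \<subseteq> ?\<Omega>" using r by auto
  have uK: "continuous_on ?K u" using u K(2) by (rule continuous_on_subset)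
  have Vb: "continuous_on A (\<lambda>x. V x \<bullet> b)" if "b \<in> Basis" for A b
    using V[OF that] has_derivative_continuous unfolding gderiv_def
    by (intro continuous_at_imp_continuous_on) blast
  have Vc: "continuous_on A V" for A
    using Vb continuous_on_componentwise by blast
  have dVc: "continuous_on A (dV b)" if "b \<in> Basis" for A b
    using dV[OF that] by (rule continuous_on_subset) simp
  have cc: "continuous_on A c" "continuous_on A d" for A
    unfolding c_def d_def by (intro continuous_intros)+
  have cz: "c x = 0" "d x = 0" if "x \<in> ?\<Omega> - ?K" for x
  proof -
    have "r\<^sup>2 \<le> (norm x)\<^sup>2" using that r by (intro power_mono) auto
    then have "k * (r\<^sup>2 - (norm x)\<^sup>2) \<le> 0" using k by (simp add: mult_nonneg_nonpos)
    then show "c x = 0" "d x = 0" by (simp_all add: c_def d_def)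
  qed
  have duK: "set_integrable lebesgue ?K du" by (rule L2_loc_imp_set_integrable[OF du K])
  have eqb: "(LINT x:?K|lebesgue. u x * (c x * (dV b x \<bullet> b) + (V x \<bullet> b) * (d x * (- 2 * k * (x \<bullet> b)))))
     = - (LINT x:?K|lebesgue. c x * (V x \<bullet> b) * (du x \<bullet> b))"
     (is "?A = - ?B") and intA: "set_integrable lebesgue ?K (\<lambda>x. u x * (c x * (dV b x \<bullet> b) + (V x \<bullet> b) * (d x * (- 2 * k * (x \<bullet> b)))))"
    and intB: "set_integrable lebesgue ?K (\<lambda>x. c x * (V x \<bullet> b) * (du x \<bullet> b))"
    if b: "b \<in> Basis" for b
  proof -
    let ?X = "\<lambda>x. u x *\<^sub>R (c x *\<^sub>R dV b x + (V x \<bullet> b) *\<^sub>R (d x *\<^sub>R ((-2 * k) *\<^sub>R x)))"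
    let ?Y = "\<lambda>x. (c x * (V x \<bullet> b)) *\<^sub>R du x"
    have X: "set_integrable lebesgue ?K ?X"
      by (intro set_integrable_continuous_compact K continuous_intros uK cc dVc[OF b] Vb[OF b])
    have Y: "set_integrable lebesgue ?K ?Y"
      by (intro set_integrable_bilinear_continuous[OF bilinear_scaleR] K duK continuous_intros cc Vb[OF b])
    have "(LINT x:?\<Omega>|lebesgue. ?X x) = - (LINT x:?\<Omega>|lebesgue. ?Y x)"
      using test_function_cut[OF r V[OF b] dV[OF b] k] weak
      unfolding weak_gradient_def c_def d_def by blast
    moreover have "(LINT x:?\<Omega>|lebesgue. ?X x) = (LINT x:?K|lebesgue. ?X x)"
      by (rule set_integral_support[OF K(2)]) (simp add: cz)
    moreover have "(LINT x:?\<Omega>|lebesgue. ?Y x) = (LINT x:?K|lebesgue. ?Y x)"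
      by (rule set_integral_support[OF K(2)]) (simp add: cz)
    ultimately have e: "(LINT x:?K|lebesgue. ?X x) = - (LINT x:?K|lebesgue. ?Y x)"
      by (simp only:)
    have "(LINT x:?K|lebesgue. ?X x) \<bullet> b = - ((LINT x:?K|lebesgue. ?Y x) \<bullet> b)"
      by (simp only: e inner_minus_left)
    then have "(LINT x:?K|lebesgue. ?X x \<bullet> b) = - (LINT x:?K|lebesgue. ?Y x \<bullet> b)"
      by (simp only: set_integral_inner_left[OF X] set_integral_inner_left[OF Y])
    then show "?A = - ?B" by (simp add: inner_add_left inner_diff_left mult.assoc)
    show "set_integrable lebesgue ?K (\<lambda>x. u x * (c x * (dV b x \<bullet> b) + (V x \<bullet> b) * (d x * (- 2 * k * (x \<bullet> b)))))"
      using set_integral_inner_left(2)[OF X, of b] by (simp add: inner_add_left inner_diff_left mult.assoc)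
    show "set_integrable lebesgue ?K (\<lambda>x. c x * (V x \<bullet> b) * (du x \<bullet> b))"
      using set_integral_inner_left(2)[OF Y, of b] by simp
  qed
  let ?div = "\<lambda>x. \<Sum>b\<in>Basis. dV b x \<bullet> b"
  have i1: "set_integrable lebesgue ?K (\<lambda>x. u x * ?div x)"
    by (intro set_integrable_continuous_compact K continuous_intros uK dVc)
  have i2: "set_integrable lebesgue ?K (\<lambda>x. V x \<bullet> du x)"
    by (intro set_integrable_bilinear_continuous[OF bilinear_inner] K duK Vc)
  show "set_integrable lebesgue ?K (\<lambda>x. u x * ?div x + V x \<bullet> du x)"
    using i1 i2 by (rule set_integral_add)
  have i3: "set_integrable lebesgue ?K (\<lambda>x. u x * (2 * k * d x) * (V x \<bullet> x))"
    by (intro set_integrable_continuous_compact K continuous_intros uK cc Vc)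
  have i4: "set_integrable lebesgue ?K (\<lambda>x. c x * (u x * ?div x))"
    by (intro set_integrable_continuous_compact K continuous_intros uK cc dVc)
  have i5: "set_integrable lebesgue ?K (\<lambda>x. c x * (V x \<bullet> du x))"
    using set_integrable_bilinear_continuous[OF bilinear_inner K(1) _ duK, of "\<lambda>x. c x *\<^sub>R V x"]
    by (simp add: continuous_intros cc Vc)
  have "(LINT x:?K|lebesgue. c x * (u x * ?div x)) - (LINT x:?K|lebesgue. u x * (2 * k * d x) * (V x \<bullet> x))
     = (LINT x:?K|lebesgue. c x * (u x * ?div x) - u x * (2 * k * d x) * (V x \<bullet> x))"
    using i4 i3 by (rule set_integral_diff(2)[symmetric])
  also have "\<dots> = (LINT x:?K|lebesgue. \<Sum>b\<in>Basis. u x * (c x * (dV b x \<bullet> b) + (V x \<bullet> b) * (d x * (- 2 * k * (x \<bullet> b)))))"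
  proof (intro arg_cong[where f = "set_lebesgue_integral lebesgue ?K"] ext)
    fix x
    have "V x \<bullet> x = (\<Sum>b\<in>Basis. (V x \<bullet> b) * (x \<bullet> b))" by (rule euclidean_inner)
    then show "c x * (u x * ?div x) - u x * (2 * k * d x) * (V x \<bullet> x)
      = (\<Sum>b\<in>Basis. u x * (c x * (dV b x \<bullet> b) + (V x \<bullet> b) * (d x * (- 2 * k * (x \<bullet> b)))))"
      by (simp add: sum_distrib_left algebra_simps sum.distrib sum_subtractf sum_negf)
  qed
  also have "\<dots> = (\<Sum>b\<in>Basis. LINT x:?K|lebesgue. u x * (c x * (dV b x \<bullet> b) + (V x \<bullet> b) * (d x * (- 2 * k * (x \<bullet> b)))))"
    using intA unfolding set_lebesgue_integral_def set_integrable_def scaleR_sum_right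
    by (intro Bochner_Integration.integral_sum) auto
  also have "\<dots> = - (\<Sum>b\<in>Basis. LINT x:?K|lebesgue. c x * (V x \<bullet> b) * (du x \<bullet> b))"
    unfolding sum_negf[symmetric] by (intro sum.cong refl eqb)
  also have "(\<Sum>b\<in>Basis. LINT x:?K|lebesgue. c x * (V x \<bullet> b) * (du x \<bullet> b))
     = (LINT x:?K|lebesgue. \<Sum>b\<in>Basis. c x * (V x \<bullet> b) * (du x \<bullet> b))"
    using intB unfolding set_lebesgue_integral_def set_integrable_def scaleR_sum_right
    by (intro Bochner_Integration.integral_sum[symmetric]) auto
  also have "\<dots> = (LINT x:?K|lebesgue. c x * (V x \<bullet> du x))"
  proof (intro arg_cong[where f = "set_lebesgue_integral lebesgue ?K"] ext)
    fix x
    have "V x \<bullet> du x = (\<Sum>b\<in>Basis. (V x \<bullet> b) * (du x \<bullet> b))" by (rule euclidean_inner)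
    then show "(\<Sum>b\<in>Basis. c x * (V x \<bullet> b) * (du x \<bullet> b)) = c x * (V x \<bullet> du x)"
      by (simp add: sum_distrib_left algebra_simps)
  qed
  finally have "(LINT x:?K|lebesgue. c x * (u x * ?div x)) + (LINT x:?K|lebesgue. c x * (V x \<bullet> du x))
      = (LINT x:?K|lebesgue. u x * (2 * k * d x) * (V x \<bullet> x))" by simp
  then show "(LINT x:?K|lebesgue. c x * (u x * ?div x + V x \<bullet> du x))
      = (LINT x:?K|lebesgue. u x * (2 * k * cut' (k * (r\<^sup>2 - (norm x)\<^sup>2))) * (V x \<bullet> x))"
    using set_integral_add(2)[OF i4 i5] by (simp add: distrib_left d_def)
qed

text \<open>A factor depending only on the norm is constant on each sphere and leaves the inner
  integral of the polar formula. The outer integral is put in the Henstock-Kurzweil form in which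
  the concentration result is stated.\<close>

lemma integral_radial_weight:
  fixes F :: "'a::euclidean_space \<Rightarrow> real"
  assumes F: "continuous_on (cball 0 r) F" and g: "continuous_on {0..r} g" and r: "r > 0"
  shows "(LINT x:cball 0 r|lebesgue. F x * g (norm x))
    = integral {0..r} (\<lambda>s. g s * (s ^ (DIM('a) - 1) * (LINT w|sphere_measure 1. F (s *\<^sub>R w))))"
    and "continuous_on {0..r} (\<lambda>s. LINT w|sphere_measure 1. F (s *\<^sub>R w))"
proof -
  let ?K = "cball (0::'a) r"
  have gn: "continuous_on ?K (\<lambda>x. g (norm x))"
    by (rule continuous_on_compose2[OF g]) (auto intro!: continuous_intros)
  have cont: "continuous_on ?K (\<lambda>x. F x * g (norm x))"
    by (intro continuous_intros F gn)
  have "continuous_on ({0..r} \<times> sphere 0 1) (\<lambda>p. F (fst p *\<^sub>R snd p))"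
    by (rule continuous_on_compose2[OF F]) (auto intro!: continuous_intros)
  then show J: "continuous_on {0..r} (\<lambda>s. LINT w|sphere_measure 1. F (s *\<^sub>R w))"
    by (intro continuous_on_sphere_integral) (simp add: split_beta')
  have int: "integrable lborel (\<lambda>x. indicator ?K x *\<^sub>R (F x * g (norm x)))"
    using set_integrable_continuous_compact(1)[OF _ cont] by (simp add: set_integrable_def)
  have "(LINT x:?K|lebesgue. F x * g (norm x)) = (LINT x|lborel. indicator ?K x *\<^sub>R (F x * g (norm x)))"
    using set_lebesgue_integral_eq_lborel[OF _ cont] by (simp add: set_lebesgue_integral_def)
  also have "\<dots> = (LINT s|lborel. indicator {0<..} s * s ^ (DIM('a) - 1) *
       (LINT w|sphere_measure 1. indicator ?K (s *\<^sub>R w) *\<^sub>R (F (s *\<^sub>R w) * g (norm (s *\<^sub>R w)))))"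
    by (rule polar_integral(2)[OF int])
  also have "\<dots> = (LINT s|lborel. indicator {0..r} s *\<^sub>R (g s * (s ^ (DIM('a) - 1) * (LINT w|sphere_measure 1. F (s *\<^sub>R w)))))"
  proof (rule integral_cong_AE)
    show "(\<lambda>s. indicator {0<..} s * s ^ (DIM('a) - 1) *
       (LINT w|sphere_measure 1. indicator ?K (s *\<^sub>R w) *\<^sub>R (F (s *\<^sub>R w) * g (norm (s *\<^sub>R w)))))
      \<in> borel_measurable lborel"
      using polar_integral(1)[OF int] by (rule borel_measurable_integrable)
    have "continuous_on {0..r} (\<lambda>s. g s * (s ^ (DIM('a) - 1) * (LINT w|sphere_measure 1. F (s *\<^sub>R w))))"
      by (intro continuous_intros g J)
    from borel_measurable_continuous_on_indicator[OF _ this]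
    show "(\<lambda>s. indicator {0..r} s *\<^sub>R (g s * (s ^ (DIM('a) - 1) * (LINT w|sphere_measure 1. F (s *\<^sub>R w)))))
        \<in> borel_measurable lborel"
      by simp
    have "AE s in lborel. s \<noteq> (0::real)" by (rule AE_lborel_singleton)
    then show "AE s in lborel. indicator {0<..} s * s ^ (DIM('a) - 1) *
       (LINT w|sphere_measure 1. indicator ?K (s *\<^sub>R w) *\<^sub>R (F (s *\<^sub>R w) * g (norm (s *\<^sub>R w))))
       = indicator {0..r} s *\<^sub>R (g s * (s ^ (DIM('a) - 1) * (LINT w|sphere_measure 1. F (s *\<^sub>R w))))"
    proof eventually_elim
      fix s :: real assume "s \<noteq> 0"
      \<comment> \<open>For negative s both indicators vanish; beyond r the inner integrand is 0
        because s w lies outside the ball.\<close>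
      then consider "s < 0" | "s > r" | "0 < s" "s \<le> r" by linarith
      then show "indicator {0<..} s * s ^ (DIM('a) - 1) *
       (LINT w|sphere_measure 1. indicator ?K (s *\<^sub>R w) *\<^sub>R (F (s *\<^sub>R w) * g (norm (s *\<^sub>R w))))
       = indicator {0..r} s *\<^sub>R (g s * (s ^ (DIM('a) - 1) * (LINT w|sphere_measure 1. F (s *\<^sub>R w))))"
      proof cases
        case 2
        have "(LINT w|sphere_measure 1. indicator ?K (s *\<^sub>R w) *\<^sub>R (F (s *\<^sub>R w) * g (norm (s *\<^sub>R w))))
            = (LINT w::'a|sphere_measure 1. (0::real))"
          using 2 r by (intro Bochner_Integration.integral_cong) (auto simp: indicator_def)
        then show ?thesis using 2 by simp
      next
        case 3
        have "(LINT w|sphere_measure 1. indicator ?K (s *\<^sub>R w) *\<^sub>R (F (s *\<^sub>R w) * g (norm (s *\<^sub>R w))))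
            = (LINT w|sphere_measure 1. F (s *\<^sub>R w) * g s)"
          using 3 by (intro Bochner_Integration.integral_cong) (auto simp: indicator_def)
        then show ?thesis using 3 by simp
      qed simp
    qed
  qed
  also have "\<dots> = (LINT s:{0..r}|lborel. g s * (s ^ (DIM('a) - 1) * (LINT w|sphere_measure 1. F (s *\<^sub>R w))))"
    by (simp add: set_lebesgue_integral_def)
  also have "\<dots> = integral {0..r} (\<lambda>s. g s * (s ^ (DIM('a) - 1) * (LINT w|sphere_measure 1. F (s *\<^sub>R w))))"
    by (intro set_borel_integral_eq_integral set_integrable_continuous_compact continuous_intros g J) simp
  finally show "(LINT x:cball 0 r|lebesgue. F x * g (norm x))
    = integral {0..r} (\<lambda>s. g s * (s ^ (DIM('a) - 1) * (LINT w|sphere_measure 1. F (s *\<^sub>R w))))" .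
qed

text \<open>In the cut-off identity k tends to infinity. The left side converges by dominated
  convergence, as the cutoff lies between 0 and 1; the right side is a one-dimensional integral
  against weights concentrating at r. Since \<open>u\<close> is continuous up to and beyond radius
  r, the limit involves its actual values on the sphere and no trace operator.\<close>

theorem divergence_ball:
  fixes u :: "'a::euclidean_space \<Rightarrow> real" and V :: "'a \<Rightarrow> 'a"
  assumes u: "continuous_on (ball 0 M) u" and du: "L2_loc (ball 0 M) du"
    and weak: "weak_gradient (ball 0 M) u du"
    and r: "0 < r" "r < M"
    and V: "\<And>b x. b \<in> Basis \<Longrightarrow> GDERIV (\<lambda>x. V x \<bullet> b) x :> dV b x"
    and dV: "\<And>b. b \<in> Basis \<Longrightarrow> continuous_on UNIV (dV b)"
  shows "(LINT x:ball 0 r|lebesgue. u x * (\<Sum>b\<in>Basis. dV b x \<bullet> b) + V x \<bullet> du x)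
    = r ^ (DIM('a) - 1) * (LINT w|sphere_measure 1. u (r *\<^sub>R w) * (V (r *\<^sub>R w) \<bullet> w))" (is "?L = ?R")
proof -
  let ?K = "cball (0::'a) r"
  define f where "f x = u x * (\<Sum>b\<in>Basis. dV b x \<bullet> b) + V x \<bullet> du x" for x
  define c where "c k x = cut (real k * (r\<^sup>2 - (norm x)\<^sup>2))" for k and x :: 'a
  have uK: "continuous_on ?K u" by (rule continuous_on_subset[OF u]) (use r in auto)
  have "continuous_on A (\<lambda>x. V x \<bullet> b)" if "b \<in> Basis" for A b
    using V[OF that] has_derivative_continuous unfolding gderiv_def
    by (intro continuous_at_imp_continuous_on) blast
  then have Vc: "continuous_on A V" for A
    using continuous_on_componentwise by blast
  have fint: "integrable lebesgue (\<lambda>x. indicator ?K x *\<^sub>R f x)"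
    using divergence_cut(2)[OF u du weak r order_refl V dV] by (simp add: set_integrable_def f_def)
  have lim1: "(\<lambda>k. LINT x:?K|lebesgue. c k x * f x) \<longlonglongrightarrow> (LINT x:ball 0 r|lebesgue. f x)"
    unfolding set_lebesgue_integral_def
  proof (rule integral_dominated_convergence[where w = "\<lambda>x. norm (indicator ?K x *\<^sub>R f x)"])
    have eq: "(\<lambda>x. indicator A x *\<^sub>R (g x * f x)) = (\<lambda>x. (indicator A x * g x) *\<^sub>R (indicator ?K x *\<^sub>R f x))"
      if "A \<subseteq> ?K" for A and g :: "'a \<Rightarrow> real"
      using that by (auto simp: fun_eq_iff indicator_def)
    have fm [measurable]: "(\<lambda>x. indicator ?K x *\<^sub>R f x) \<in> borel_measurable lebesgue"
      using fint by (rule borel_measurable_integrable)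
    have "c k \<in> borel_measurable borel" for k
      unfolding c_def by (intro borel_measurable_continuous_onI continuous_intros)
    then have cm: "c k \<in> borel_measurable lebesgue" for k
      by (intro measurable_completion) simp
    have im: "(indicator ?K :: 'a \<Rightarrow> real) \<in> borel_measurable lebesgue"
       "(indicator (ball 0 r) :: 'a \<Rightarrow> real) \<in> borel_measurable lebesgue"
      by (auto intro!: borel_measurable_indicator)
    show "(\<lambda>x. indicator ?K x *\<^sub>R (c k x * f x)) \<in> borel_measurable lebesgue" for k
      by (subst eq[OF order_refl]) (intro borel_measurable_scaleR borel_measurable_times im cm fm)
    show "(\<lambda>x. indicator (ball 0 r) x *\<^sub>R f x) \<in> borel_measurable lebesgue"
      using eq[of "ball 0 r" "\<lambda>_. 1"] by (simp only: ball_subset_cball mult_1 mult_1_right)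
        (intro borel_measurable_scaleR im fm)
    show "integrable lebesgue (\<lambda>x. norm (indicator ?K x *\<^sub>R f x))"
      using fint by (rule integrable_norm)
    show "AE x in lebesgue. norm (indicator ?K x *\<^sub>R (c k x * f x)) \<le> norm (indicator ?K x *\<^sub>R f x)" for k
      using cut_bounds by (intro AE_I2)
        (auto simp: c_def abs_mult indicator_def intro!: mult_left_le_one_le)
    show "AE x in lebesgue. (\<lambda>k. indicator ?K x *\<^sub>R (c k x * f x)) \<longlonglongrightarrow> indicator (ball 0 r) x *\<^sub>R f x"
    proof (rule AE_I2)
      fix x :: 'a
      show "(\<lambda>k. indicator ?K x *\<^sub>R (c k x * f x)) \<longlonglongrightarrow> indicator (ball 0 r) x *\<^sub>R f x"
      proof (cases "x \<in> ball 0 r")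
        case True
        then have "r\<^sup>2 - (norm x)\<^sup>2 > 0" by (simp add: power_strict_mono)
        then have "(\<lambda>k. c k x * f x) \<longlonglongrightarrow> 1 * f x"
          unfolding c_def by (intro tendsto_intros tendsto_cut)
        then show ?thesis using True by (simp add: indicator_def)
      next
        case False
        then have "r\<^sup>2 \<le> (norm x)\<^sup>2" using r by (intro power_mono) auto
        then have "c k x = 0" for k by (simp add: c_def mult_nonneg_nonpos)
        then show ?thesis using False by simp
      qed
    qed
  qed
  \<comment> \<open>The flux of u V through the sphere of radius s; w is the outer unit
    normal.\<close>
  define H where "H s = s ^ (DIM('a) - 1) * (LINT w|sphere_measure 1. u (s *\<^sub>R w) * (V (s *\<^sub>R w) \<bullet> w))" for s
  have Hc: "continuous_on {0..r} H"
  proof -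
    have "continuous_on ({0..r} \<times> sphere 0 1) (\<lambda>p. u (fst p *\<^sub>R snd p) * (V (fst p *\<^sub>R snd p) \<bullet> snd p))"
      by (intro continuous_intros continuous_on_compose2[OF uK] continuous_on_compose2[OF Vc[of UNIV]]) auto
    then show ?thesis unfolding H_def
      by (intro continuous_intros continuous_on_sphere_integral) (simp add: split_beta')
  qed
  have eq: "(LINT x:?K|lebesgue. c k x * f x)
      = integral {0..r} (\<lambda>s. 2 * real k * s * cut' (real k * (r\<^sup>2 - s\<^sup>2)) * H s)" for k
  proof -
    have "(LINT x:?K|lebesgue. c k x * f x)
       = (LINT x:?K|lebesgue. (u x * (V x \<bullet> x)) * (2 * real k * cut' (real k * (r\<^sup>2 - (norm x)\<^sup>2))))"
      using divergence_cut(1)[OF u du weak r of_nat_0_le_iff V dV, of k]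
      by (simp only: f_def c_def ac_simps)
    also have "\<dots> = integral {0..r} (\<lambda>s. (2 * real k * cut' (real k * (r\<^sup>2 - s\<^sup>2))) * (s ^ (DIM('a) - 1)
        * (LINT w|sphere_measure 1. u (s *\<^sub>R w) * (V (s *\<^sub>R w) \<bullet> (s *\<^sub>R w)))))"
      by (rule integral_radial_weight(1)) (intro continuous_intros uK Vc r)+
    also have "\<dots> = integral {0..r} (\<lambda>s. 2 * real k * s * cut' (real k * (r\<^sup>2 - s\<^sup>2)) * H s)"
    proof (intro arg_cong[where f = "integral {0..r}"] ext)
      fix s
      \<comment> \<open>The position vector is s times the normal, and this factor s completes the
        weight demanded by \<open>cut_concentrates\<close>.\<close>
      have "(\<lambda>w. u (s *\<^sub>R w) * (V (s *\<^sub>R w) \<bullet> (s *\<^sub>R w))) = (\<lambda>w. s * (u (s *\<^sub>R w) * (V (s *\<^sub>R w) \<bullet> w)))"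
        by (simp add: fun_eq_iff)
      then show "(2 * real k * cut' (real k * (r\<^sup>2 - s\<^sup>2))) * (s ^ (DIM('a) - 1)
        * (LINT w|sphere_measure 1. u (s *\<^sub>R w) * (V (s *\<^sub>R w) \<bullet> (s *\<^sub>R w))))
        = 2 * real k * s * cut' (real k * (r\<^sup>2 - s\<^sup>2)) * H s"
        unfolding H_def by (simp only: integral_mult_right_zero) simp
    qed
    finally show ?thesis .
  qed
  have "(\<lambda>k. LINT x:?K|lebesgue. c k x * f x) \<longlonglongrightarrow> H r"
    unfolding eq by (rule cut_concentrates[OF Hc r(1)])
  then have "(LINT x:ball 0 r|lebesgue. f x) = H r"
    using lim1 LIMSEQ_unique by blast
  then show ?thesis by (simp add: f_def H_def)
qed

section \<open>Integration by parts for continuously differentiable functions\<close>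

lemma GDERIV_unique:
  assumes "GDERIV f x :> D" "GDERIV f x :> E"
  shows "D = E"
proof -
  have "(\<lambda>h. h \<bullet> D) = (\<lambda>h. h \<bullet> E)"
    using assms has_derivative_unique unfolding gderiv_def by blast
  then have "(D - E) \<bullet> D = (D - E) \<bullet> E" by (rule fun_cong)
  then have "(D - E) \<bullet> (D - E) = 0" by (simp add: inner_diff_right)
  then show ?thesis by simp
qed

lemma GDERIV_line:
  assumes "GDERIV f (x + t *\<^sub>R c) :> D"
  shows "((\<lambda>t. f (x + t *\<^sub>R c)) has_real_derivative D \<bullet> c) (at t)"
proof -
  have "((\<lambda>t. x + t *\<^sub>R c) has_derivative (\<lambda>h. h *\<^sub>R c)) (at t)"
    by (auto intro!: derivative_eq_intros)
  from has_derivative_compose[OF this assms[unfolded gderiv_def]]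
  show ?thesis
    unfolding has_field_derivative_def by (rule has_derivative_eq_rhs) (auto simp: inner_commute)
qed

text \<open>Difference quotients of \<open>f\<close> along \<open>c\<close> integrate to 0 by
  translation invariance and converge to the directional derivative; the mean value theorem supplies
  the dominating function.\<close>

lemma integral_gradient_eq_0:
  fixes f :: "'a::euclidean_space \<Rightarrow> real"
  assumes f: "\<And>x. GDERIV f x :> df x" and df: "continuous_on UNIV df"
    and supp: "\<And>x. R < norm x \<Longrightarrow> f x = 0"
  shows "(LINT x|lborel. df x \<bullet> c) = 0"
proof -
  define h where "h n = inverse (real (Suc n))" for n
  have h: "0 < h n" "h n \<le> 1" for n by (auto simp: h_def field_simps)
  define q where "q n x = (f (x + h n *\<^sub>R c) - f x) / h n" for n x
  have fc: "continuous_on A f" for A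
    using f has_derivative_continuous unfolding gderiv_def
    by (intro continuous_at_imp_continuous_on) blast
  \<comment> \<open>The steps \<open>h n\<close> are at most 1, so a quotient is nonzero only where
    norm x \<le> R + norm c, and the intermediate points then have norm at most R + 2 norm c, the
    radius on which \<open>B\<close> bounds the gradient.\<close>
  define K where "K = cball (0::'a) (R + norm c)"
  have "bounded (df ` cball 0 (R + 2 * norm c))"
    by (intro compact_imp_bounded compact_continuous_image continuous_on_subset[OF df]) auto
  then obtain B where "B > 0" "\<forall>x\<in>cball 0 (R + 2 * norm c). norm (df x) \<le> B"
    unfolding bounded_pos by auto
  then have B: "\<And>x. norm x \<le> R + 2 * norm c \<Longrightarrow> norm (df x) \<le> B" "B > 0"
    by auto
  have qb: "norm (q n x) \<le> indicator K x *\<^sub>R (B * norm c)" for n x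
  proof (cases "x \<in> K")
    case True
    obtain z where z: "0 < z" "z < h n"
      and e: "f (x + h n *\<^sub>R c) - f (x + 0 *\<^sub>R c) = (h n - 0) * (df (x + z *\<^sub>R c) \<bullet> c)"
      using MVT2[OF h(1)[of n], of "\<lambda>t. f (x + t *\<^sub>R c)" "\<lambda>t. df (x + t *\<^sub>R c) \<bullet> c"] GDERIV_line[OF f]
      by blast
    have "q n x = df (x + z *\<^sub>R c) \<bullet> c"
      using e h(1)[of n] by (simp add: q_def)
    then have "norm (q n x) \<le> norm (df (x + z *\<^sub>R c)) * norm c"
      by (simp add: Cauchy_Schwarz_ineq2)
    also have "norm (df (x + z *\<^sub>R c)) \<le> B"
    proof (rule B)
      have "z * norm c \<le> 1 * norm c" using z h[of n] by (intro mult_right_mono) auto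
      then show "norm (x + z *\<^sub>R c) \<le> R + 2 * norm c"
        using True z norm_triangle_ineq[of x "z *\<^sub>R c"] by (auto simp: K_def)
    qed
    finally show ?thesis using True by (simp add: mult_right_mono)
  next
    case False
    have "h n * norm c \<le> 1 * norm c" using h[of n] by (intro mult_right_mono) auto
    moreover have "norm x > R + norm c" using False by (auto simp: K_def)
    moreover have "norm x - h n * norm c \<le> norm (x + h n *\<^sub>R c)"
      using h(1)[of n] norm_triangle_ineq2[of x "- (h n *\<^sub>R c)"] by simp
    ultimately have "R < norm (x + h n *\<^sub>R c)" "R < norm x"
      using norm_ge_zero[of c] by linarith+
    then show ?thesis using False by (simp add: q_def supp)
  qed
  have qm: "q n \<in> borel_measurable lborel" for n
    unfolding q_def using fc h(1)[of n]
    by (auto intro!: borel_measurable_continuous_onI continuous_intros continuous_on_compose2[OF fc[of UNIV]])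
  have lim: "(\<lambda>n. LINT x|lborel. q n x) \<longlonglongrightarrow> (LINT x|lborel. df x \<bullet> c)"
  proof (rule integral_dominated_convergence[where w = "\<lambda>x. indicator K x *\<^sub>R (B * norm c)"])
    show "(\<lambda>x. df x \<bullet> c) \<in> borel_measurable lborel"
      using df by (auto intro!: borel_measurable_continuous_onI continuous_intros)
    show "integrable lborel (\<lambda>x. indicator K x *\<^sub>R (B * norm c))"
      using set_integrable_continuous_compact(1)[of K "\<lambda>_. B * norm c"]
      by (simp add: set_integrable_def K_def)
    show "AE x in lborel. (\<lambda>n. q n x) \<longlonglongrightarrow> df x \<bullet> c"
    proof (rule AE_I2)
      fix x
      have "((\<lambda>t. (f (x + (0 + t) *\<^sub>R c) - f (x + 0 *\<^sub>R c)) / t) \<longlongrightarrow> df x \<bullet> c) (at 0)"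
        using GDERIV_line[of f x 0 c "df x"] f[of x] unfolding DERIV_def by simp
      moreover have "filterlim h (at 0) sequentially"
        unfolding filterlim_at using h(1) LIMSEQ_inverse_real_of_nat
        by (auto simp: h_def[abs_def] intro!: always_eventually)
      ultimately show "(\<lambda>n. q n x) \<longlonglongrightarrow> df x \<bullet> c"
        unfolding q_def by (auto dest: filterlim_compose)
    qed
  qed (use qm qb in auto)
  have fint: "integrable lborel f"
  proof -
    have "f = (\<lambda>x. indicator (cball 0 R) x *\<^sub>R f x)"
      using supp by (force simp: indicator_def fun_eq_iff)
    then show ?thesis
      using set_integrable_continuous_compact(1)[of "cball 0 R" f] fc by (simp add: set_integrable_def)
  qed
  have "(LINT x|lborel. q n x) = 0" for n
  proof -
    have fm: "f \<in> borel_measurable borel" using fint by auto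
    have "integrable (distr lborel borel ((+) (h n *\<^sub>R c))) f"
      "integral\<^sup>L (distr lborel borel ((+) (h n *\<^sub>R c))) f = (LINT x|lborel. f x)"
      using fint by (simp_all only: lborel_distr_plus)
    then have "integrable lborel (\<lambda>x. f (x + h n *\<^sub>R c))"
        "(LINT x|lborel. f (x + h n *\<^sub>R c)) = (LINT x|lborel. f x)"
      using fm by (simp_all add: integrable_distr_eq integral_distr add.commute)
    then show ?thesis
      using fint unfolding q_def by (simp add: Bochner_Integration.integral_diff)
  qed
  then show ?thesis using lim by (simp add: LIMSEQ_const_iff)
qed

text \<open>The product of \<open>w\<close> with a test function is C^1 with compact support, so its
  gradient integrates to 0, and the product rule gives the claim. Polynomials thereby become
  admissible in the divergence theorem for weak gradients.\<close>

lemma weak_gradient_C1: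
  fixes w :: "'a::euclidean_space \<Rightarrow> real"
  assumes w: "\<And>x. GDERIV w x :> dw x" and dw: "continuous_on UNIV dw"
  shows "weak_gradient \<Omega> w dw"
  unfolding weak_gradient_def
proof (intro allI impI)
  fix \<phi> d\<phi> assume "test_function \<Omega> \<phi> d\<phi>"
  then have \<phi>: "\<And>x. GDERIV \<phi> x :> d\<phi> x" and d\<phi>: "continuous_on UNIV d\<phi>"
    and K0: "compact (closure {x. \<phi> x \<noteq> 0})" "closure {x. \<phi> x \<noteq> 0} \<subseteq> \<Omega>"
    unfolding test_function_def by auto
  define K where "K = closure {x. \<phi> x \<noteq> 0}"
  have K: "compact K" "K \<subseteq> \<Omega>" unfolding K_def by (rule K0)+
  have z1: "\<phi> x = 0" if "x \<notin> K" for x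
    using that closure_subset[of "{x. \<phi> x \<noteq> 0}"] by (auto simp: K_def)
  \<comment> \<open>Off the closed set \<open>K\<close> the test function vanishes in a whole
    neighbourhood, hence so does its gradient.\<close>
  have z2: "d\<phi> x = 0" if "x \<notin> K" for x
  proof (rule GDERIV_unique[OF \<phi>])
    have "((\<lambda>_. 0) has_derivative (\<lambda>h. h \<bullet> 0)) (at x)" by simp
    then show "GDERIV \<phi> x :> 0"
      unfolding gderiv_def
      by (rule has_derivative_transform_within_open[of _ _ _ _ "- K"])
        (use that K z1 in \<open>auto simp: compact_imp_closed open_Compl\<close>)
  qed
  have wc: "continuous_on A w" for A
    using w has_derivative_continuous unfolding gderiv_def
    by (intro continuous_at_imp_continuous_on) blast
  have \<phi>c: "continuous_on A \<phi>" for A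
    using \<phi> has_derivative_continuous unfolding gderiv_def
    by (intro continuous_at_imp_continuous_on) blast
  have dc: "continuous_on A dw" "continuous_on A d\<phi>" for A
    using dw d\<phi> continuous_on_subset by blast+
  obtain R where R: "\<And>x. x \<in> K \<Longrightarrow> norm x \<le> R"
    using compact_imp_bounded[OF K(1)] unfolding bounded_iff by blast
  have i: "set_integrable lebesgue K (\<lambda>x. w x *\<^sub>R d\<phi> x)" "set_integrable lebesgue K (\<lambda>x. \<phi> x *\<^sub>R dw x)"
    by (intro set_integrable_continuous_compact K continuous_intros wc \<phi>c dc)+
  let ?g = "\<lambda>x. w x *\<^sub>R d\<phi> x + \<phi> x *\<^sub>R dw x"
  have g: "set_integrable lborel K ?g"
    by (intro set_integrable_continuous_compact K continuous_intros wc \<phi>c dc)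
  have e: "(\<lambda>x. indicator K x *\<^sub>R ?g x) = ?g"
    using z1 z2 by (force simp: indicator_def fun_eq_iff)
  have gi: "integrable lborel ?g" using g unfolding set_integrable_def e .
  have g0: "(LINT x:K|lebesgue. ?g x) = 0"
  proof (rule euclidean_eqI)
    fix b :: 'a assume "b \<in> Basis"
    have "(LINT x:K|lebesgue. ?g x) = (LINT x:K|lborel. ?g x)"
      by (intro set_lebesgue_integral_eq_lborel continuous_intros wc \<phi>c dc)
        (use K in \<open>auto simp: borel_compact\<close>)
    also have "\<dots> = (LINT x|lborel. ?g x)"
      unfolding set_lebesgue_integral_def e ..
    also have "\<dots> \<bullet> b = (LINT x|lborel. ?g x \<bullet> b)"
      by (rule integral_inner_left[symmetric]) (rule gi)
    also have "\<dots> = 0"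
    proof (rule integral_gradient_eq_0[where f = "\<lambda>x. w x * \<phi> x" and R = R])
      show "GDERIV (\<lambda>x. w x * \<phi> x) x :> ?g x" for x by (rule GDERIV_mult[OF w \<phi>])
      show "continuous_on UNIV ?g" by (intro continuous_intros wc \<phi>c dc)
      show "R < norm x \<Longrightarrow> w x * \<phi> x = 0" for x using R[of x] z1[of x] by force
    qed
    finally show "(LINT x:K|lebesgue. ?g x) \<bullet> b = 0 \<bullet> b" by simp
  qed
  have "(LINT x:\<Omega>|lebesgue. w x *\<^sub>R d\<phi> x) = (LINT x:K|lebesgue. w x *\<^sub>R d\<phi> x)"
    by (rule set_integral_support[OF K(2)]) (simp add: z2)
  moreover have "(LINT x:\<Omega>|lebesgue. \<phi> x *\<^sub>R dw x) = (LINT x:K|lebesgue. \<phi> x *\<^sub>R dw x)"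
    by (rule set_integral_support[OF K(2)]) (simp add: z1)
  ultimately show "(LINT x:\<Omega>|lebesgue. w x *\<^sub>R d\<phi> x) = - (LINT x:\<Omega>|lebesgue. \<phi> x *\<^sub>R dw x)"
    using g0 set_integral_add(2)[OF i] by (simp add: eq_neg_iff_add_eq_0)
qed

lemma L2_loc_continuous:
  fixes f :: "'a::euclidean_space \<Rightarrow> 'b::euclidean_space"
  assumes "open \<Omega>" "continuous_on \<Omega> f"
  shows "L2_loc \<Omega> f"
  unfolding L2_loc_def
proof (intro conjI allI impI)
  show "set_borel_measurable lebesgue \<Omega> f"
    unfolding set_borel_measurable_def
    using borel_measurable_continuous_on_indicator[of \<Omega> f] assms
    by (intro measurable_completion) simp
  show "set_integrable lebesgue K (\<lambda>x. (norm (f x))\<^sup>2)" if "compact K" "K \<subseteq> \<Omega>" for K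
    using that assms by (intro set_integrable_continuous_compact continuous_intros)
      (auto intro: continuous_on_subset)
qed


section \<open>Gradients of polynomials\<close>

text \<open>Choice makes the gradient a function of \<open>p\<close> alone, so that it can be
  applied again to the coordinates of a gradient. Where a gradient exists it is unique, so nothing
  is arbitrary for polynomials.\<close>

definition grad :: "('a::euclidean_space \<Rightarrow> real) \<Rightarrow> 'a \<Rightarrow> 'a" where
  "grad p x = (SOME D. GDERIV p x :> D)"

lemma grad_eqI: "GDERIV p x :> D \<Longrightarrow> grad p x = D"
  unfolding grad_def by (metis GDERIV_unique someI)

text \<open>The induction also records that every coordinate of the gradient is again a polynomial;
  second derivatives and polynomial vector fields rest on this.\<close>

lemma real_polynomial_function_GDERIV:
  fixes p :: "'a::euclidean_space \<Rightarrow> real"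
  assumes "real_polynomial_function p"
  shows "\<exists>dp. (\<forall>x. GDERIV p x :> dp x) \<and> (\<forall>b. real_polynomial_function (\<lambda>x. dp x \<bullet> b))"
  using assms
proof (induction p rule: real_polynomial_function.induct)
  case (linear f)
  interpret bounded_linear f by fact
  define D where "D = (\<Sum>b\<in>Basis. f b *\<^sub>R b)"
  have "f h = h \<bullet> D" for h
  proof -
    have "f h = f (\<Sum>b\<in>Basis. (h \<bullet> b) *\<^sub>R b)" by (simp add: euclidean_representation)
    also have "\<dots> = h \<bullet> D" by (simp add: D_def sum scaleR inner_sum_right mult.commute)
    finally show ?thesis .
  qed
  then have "f = (\<lambda>h. h \<bullet> D)" by blast
  then have "GDERIV f x :> D" for x
    unfolding gderiv_def by (auto intro!: derivative_eq_intros)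
  then show ?case by (intro exI[of _ "\<lambda>_. D"]) auto
next
  case (const c)
  show ?case by (intro exI[of _ "\<lambda>_. 0"]) (auto simp: GDERIV_const)
next
  case (add f g)
  then obtain df dg where "\<forall>x. GDERIV f x :> df x" "\<forall>b. real_polynomial_function (\<lambda>x. df x \<bullet> b)"
    "\<forall>x. GDERIV g x :> dg x" "\<forall>b. real_polynomial_function (\<lambda>x. dg x \<bullet> b)" by blast
  then show ?case
    by (intro exI[of _ "\<lambda>x. df x + dg x"]) (auto simp: GDERIV_add inner_add_left)
next
  case (mult f g)
  then obtain df dg where "\<forall>x. GDERIV f x :> df x" "\<forall>b. real_polynomial_function (\<lambda>x. df x \<bullet> b)"
    "\<forall>x. GDERIV g x :> dg x" "\<forall>b. real_polynomial_function (\<lambda>x. dg x \<bullet> b)" by blast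
  then show ?case using mult.hyps
    by (intro exI[of _ "\<lambda>x. f x *\<^sub>R dg x + g x *\<^sub>R df x"]) (auto simp: GDERIV_mult inner_add_left intro!: real_polynomial_function.intros(3,4))
qed

lemma
  assumes "real_polynomial_function p"
  shows GDERIV_grad: "GDERIV p x :> grad p x"
    and real_polynomial_function_grad: "real_polynomial_function (\<lambda>x. grad p x \<bullet> b)"
proof -
  obtain dp where dp: "\<forall>x. GDERIV p x :> dp x" "\<forall>b. real_polynomial_function (\<lambda>x. dp x \<bullet> b)"
    using real_polynomial_function_GDERIV[OF assms] by blast
  then have "grad p = dp" by (intro ext grad_eqI) auto
  then show "GDERIV p x :> grad p x" "real_polynomial_function (\<lambda>x. grad p x \<bullet> b)"
    using dp by auto
qed

lemma continuous_on_real_polynomial_function: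
  "real_polynomial_function (p :: 'a::euclidean_space \<Rightarrow> real) \<Longrightarrow> continuous_on A p"
  by (intro continuous_at_imp_continuous_on ballI continuous_real_polymonial_function)

lemma continuous_on_grad: "real_polynomial_function p \<Longrightarrow> continuous_on A (grad p)"
  by (subst continuous_on_componentwise)
    (auto intro: continuous_on_real_polynomial_function real_polynomial_function_grad)

lemma divergence_ball_polynomial:
  fixes u :: "'a::euclidean_space \<Rightarrow> real" and V :: "'a \<Rightarrow> 'a"
  assumes "continuous_on (ball 0 M) u" "L2_loc (ball 0 M) du" "weak_gradient (ball 0 M) u du"
    and "0 < r" "r < M"
    and V: "\<And>b. b \<in> Basis \<Longrightarrow> real_polynomial_function (\<lambda>x. V x \<bullet> b)"
  shows "(LINT x:ball 0 r|lebesgue. u x * (\<Sum>b\<in>Basis. grad (\<lambda>x. V x \<bullet> b) x \<bullet> b) + V x \<bullet> du x)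
    = r ^ (DIM('a) - 1) * (LINT w|sphere_measure 1. u (r *\<^sub>R w) * (V (r *\<^sub>R w) \<bullet> w))"
  by (rule divergence_ball[OF assms(1-5)]) (auto intro: GDERIV_grad continuous_on_grad V)

lemma
  assumes "real_polynomial_function p"
  shows weak_gradient_polynomial: "weak_gradient \<Omega> p (grad p)"
    and L2_loc_grad: "open \<Omega> \<Longrightarrow> L2_loc \<Omega> (grad p)"
  using assms
  by (auto intro!: weak_gradient_C1 L2_loc_continuous GDERIV_grad continuous_on_grad)

section \<open>The Euler operator on polynomials\<close>

text \<open>Neither the degrees nor uniqueness of the decomposition are recorded: the equation to be
  solved with it is linear, so solutions on homogeneous parts can simply be added.\<close>

inductive homogeneous_sum :: "('a::euclidean_space \<Rightarrow> real) \<Rightarrow> bool" where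
  homogeneous: "real_polynomial_function p \<Longrightarrow> (\<And>c x. p (c *\<^sub>R x) = c ^ k * p x) \<Longrightarrow> homogeneous_sum p"
| sum: "homogeneous_sum p \<Longrightarrow> homogeneous_sum q \<Longrightarrow> homogeneous_sum (\<lambda>x. p x + q x)"

lemma homogeneous_sum_mult:
  assumes "homogeneous_sum p" "homogeneous_sum q"
  shows "homogeneous_sum (\<lambda>x. p x * q x)"
  using assms
proof (induction p)
  case (homogeneous p k)
  note p = homogeneous(1,2)
  from \<open>homogeneous_sum q\<close> show ?case
  proof (induction q)
    case (homogeneous q j)
    show ?case
      by (rule homogeneous_sum.homogeneous[where k = "k + j"])
        (auto simp: p homogeneous power_add intro: real_polynomial_function.intros)
  next
    case (sum q1 q2)
    then show ?case using homogeneous_sum.sum by (fastforce simp: distrib_left)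
  qed
next
  case (sum p1 p2)
  then show ?case using homogeneous_sum.sum by (fastforce simp: distrib_right)
qed

lemma real_polynomial_function_imp_homogeneous_sum:
  assumes "real_polynomial_function p"
  shows "homogeneous_sum p"
  using assms
proof (induction p rule: real_polynomial_function.induct)
  case (linear f)
  then show ?case
    by (intro homogeneous_sum.homogeneous[where k = 1])
      (auto simp: linear_simps intro: real_polynomial_function.intros)
next
  case (const c)
  show ?case
    by (intro homogeneous_sum.homogeneous[where k = 0]) (auto intro: real_polynomial_function.intros)
next
  case (add f g)
  then show ?case by (intro homogeneous_sum.sum)
next
  case (mult f g)
  then show ?case by (intro homogeneous_sum_mult)
qed

text \<open>Euler's relation, from differentiating p(t x) = t^k p(x) at t = 1.\<close>

lemma euler_homogeneous:
  assumes p: "real_polynomial_function p" and hom: "\<And>c x. p (c *\<^sub>R x) = c ^ k * p x"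
  shows "grad p x \<bullet> x = real k * p x"
proof -
  have "((\<lambda>t. p (0 + t *\<^sub>R x)) has_real_derivative grad p x \<bullet> x) (at 1)"
    by (rule GDERIV_line) (use GDERIV_grad[OF p] in simp)
  moreover have "((\<lambda>t. p (0 + t *\<^sub>R x)) has_real_derivative real k * p x) (at 1)"
    unfolding add_0 hom by (auto intro!: derivative_eq_intros)
  ultimately show ?thesis by (rule DERIV_unique)
qed

lemma grad_add:
  assumes "real_polynomial_function p" "real_polynomial_function q"
  shows "grad (\<lambda>x. p x + q x) x = grad p x + grad q x"
  by (intro grad_eqI GDERIV_add GDERIV_grad assms)

lemma grad_mult:
  assumes "real_polynomial_function p" "real_polynomial_function q"
  shows "grad (\<lambda>x. p x * q x) x = p x *\<^sub>R grad q x + q x *\<^sub>R grad p x"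
  by (intro grad_eqI GDERIV_mult GDERIV_grad assms)

lemma real_polynomial_function_coordinate: "real_polynomial_function (\<lambda>x. x \<bullet> b)"
  by (rule real_polynomial_function.intros(1)) (rule bounded_linear_inner_left)

lemma grad_coordinate: "grad (\<lambda>x. x \<bullet> b) x = b"
  by (intro grad_eqI) (auto simp: gderiv_def intro!: derivative_eq_intros)

lemma grad_cmult:
  assumes "real_polynomial_function p"
  shows "grad (\<lambda>x. c * p x) x = c *\<^sub>R grad p x"
  using grad_mult[OF real_polynomial_function.intros(2) assms, of c x]
    grad_eqI[OF GDERIV_const, of c x] by simp

text \<open>In dimension \<open>m\<close> the left-hand side is the divergence of the radial field \<open>w x *\<^sub>R x\<close>.\<close>

lemma ex_radial_potential:
  assumes "real_polynomial_function g" and m: "m > 0"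
  shows "\<exists>w. real_polynomial_function w \<and> (\<forall>x. real m * w x + grad w x \<bullet> x = g x)"
  using real_polynomial_function_imp_homogeneous_sum[OF assms(1)]
proof induction
  case (homogeneous p k)
  \<comment> \<open>By Euler's relation the operator multiplies a homogeneous polynomial of degree k
    by m + k, so division by that number inverts it; m > 0 keeps it nonzero even on
    constants.\<close>
  have "real_polynomial_function (\<lambda>x. inverse (real (m + k)) * p x)"
    using homogeneous by (auto intro: real_polynomial_function.intros)
  moreover have "real m * (inverse (real (m + k)) * p x)
      + grad (\<lambda>x. inverse (real (m + k)) * p x) x \<bullet> x = p x" for x
  proof -
    have "real m * (inverse (real (m + k)) * p x) + inverse (real (m + k)) * (real k * p x)
        = inverse (real (m + k)) * real (m + k) * p x" by (simp add: algebra_simps)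
    also have "\<dots> = p x" using m by simp
    finally show ?thesis
      using euler_homogeneous[OF homogeneous, of x] by (simp add: grad_cmult[OF homogeneous(1)])
  qed
  ultimately show ?case by blast
next
  case (sum p q)
  then obtain v w where "real_polynomial_function v" "\<forall>x. real m * v x + grad v x \<bullet> x = p x"
    "real_polynomial_function w" "\<forall>x. real m * w x + grad w x \<bullet> x = q x" by blast
  then show ?case
    by (intro exI[of _ "\<lambda>x. v x + w x"])
      (auto simp: grad_add inner_add_left algebra_simps intro: real_polynomial_function.intros)
qed


section \<open>A Poincare inequality with boundary term\<close>

text \<open>The integral over the sphere of radius r, pulled back to the unit sphere as the
  divergence theorem yields it. For r > 0 and continuous \<open>f\<close> it is the integral against
  \<open>sphere_measure r\<close>, by \<open>integral_sphere_measure_scale\<close>.\<close>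

definition surface_integral :: "real \<Rightarrow> ('a::euclidean_space \<Rightarrow> real) \<Rightarrow> real" where
  "surface_integral r f = r ^ (DIM('a) - 1) * (LINT w|sphere_measure 1. f (r *\<^sub>R w))"

lemma surface_integral_mono:
  fixes f g :: "'a::euclidean_space \<Rightarrow> real"
  assumes r: "r > 0" and f: "continuous_on (sphere 0 r) f" and g: "continuous_on (sphere 0 r) g"
    and le: "\<And>x. norm x = r \<Longrightarrow> f x \<le> g x"
  shows "surface_integral r f \<le> surface_integral r g"
proof -
  have "integrable (sphere_measure 1) (\<lambda>w. h (r *\<^sub>R w))" if "continuous_on (sphere 0 r) h" for h :: "'a \<Rightarrow> real"
    using r by (intro integrable_sphere_measure continuous_on_compose2[OF that] continuous_intros) auto
  then have "(LINT w|sphere_measure 1. f (r *\<^sub>R w)) \<le> (LINT w|sphere_measure 1. g (r *\<^sub>R w))"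
    using r f g le by (intro integral_mono) auto
  then show ?thesis using r by (simp add: surface_integral_def mult_left_mono)
qed

lemma surface_integral_add:
  fixes f g :: "'a::euclidean_space \<Rightarrow> real"
  assumes r: "r > 0" and f: "continuous_on (sphere 0 r) f" and g: "continuous_on (sphere 0 r) g"
  shows "surface_integral r (\<lambda>x. f x + g x) = surface_integral r f + surface_integral r g"
proof -
  have "integrable (sphere_measure 1) (\<lambda>w. h (r *\<^sub>R w))" if "continuous_on (sphere 0 r) h" for h :: "'a \<Rightarrow> real"
    using r by (intro integrable_sphere_measure continuous_on_compose2[OF that] continuous_intros) auto
  then show ?thesis using f g by (simp add: surface_integral_def algebra_simps)
qed

lemma surface_integral_cmult: "surface_integral r (\<lambda>x. c * f x) = c * surface_integral r f"
  by (simp add: surface_integral_def)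

lemma set_integrable_ball:
  fixes f :: "'a::euclidean_space \<Rightarrow> 'b::euclidean_space"
  assumes "set_integrable lebesgue (cball 0 r) f"
  shows "set_integrable lebesgue (ball 0 r) f"
  using assms by (rule set_integrable_subset) auto

lemmas set_integrable_ball_continuous =
  set_integrable_ball[OF set_integrable_continuous_compact(2)[OF compact_cball]]

lemma set_integral_mono_set:
  fixes f :: "'a \<Rightarrow> real"
  assumes "set_integrable M B f" "A \<subseteq> B" "\<And>x. 0 \<le> f x"
  shows "(LINT x:A|M. f x) \<le> (LINT x:B|M. f x)"
  using assms unfolding set_integrable_def set_lebesgue_integral_def
  by (intro integral_mono') (auto split: split_indicator)

text \<open>The divergence theorem for the field w^2 x, whose divergence n w^2 + 2 w (grad w
  \<bullet> x) is 2 w g - n w^2 by the equation for \<open>w\<close>. It trades the boundary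
  integral of w^2 for interior terms with a favourable sign in w^2.\<close>

lemma radial_potential_energy:
  fixes w :: "'a::euclidean_space \<Rightarrow> real"
  assumes w: "real_polynomial_function w" and r: "r > 0"
    and eq: "\<And>x. real DIM('a) * w x + grad w x \<bullet> x = g x"
  shows "(LINT x:ball 0 r|lebesgue. 2 * (w x * g x) - real DIM('a) * (w x)\<^sup>2)
     = r * surface_integral r (\<lambda>x. (w x)\<^sup>2)"
proof -
  have w2: "real_polynomial_function (\<lambda>x. w x * w x)"
    using w by (auto intro: real_polynomial_function.intros)
  have "(LINT x:ball 0 r|lebesgue. w x * w x * (\<Sum>b\<in>Basis. grad (\<lambda>x. x \<bullet> b) x \<bullet> b)
        + x \<bullet> grad (\<lambda>x. w x * w x) x)
      = r ^ (DIM('a) - 1) * (LINT v|sphere_measure 1. w (r *\<^sub>R v) * w (r *\<^sub>R v) * ((r *\<^sub>R v) \<bullet> v))"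
    by (rule divergence_ball_polynomial[where M = "r + 1"])
      (use r in \<open>auto intro!: continuous_on_real_polynomial_function w2 L2_loc_grad weak_gradient_polynomial
          real_polynomial_function_coordinate\<close>)
  moreover have "w x * w x * (\<Sum>b\<in>Basis. grad (\<lambda>x. x \<bullet> b) x \<bullet> b) + x \<bullet> grad (\<lambda>x. w x * w x) x
      = 2 * (w x * g x) - real DIM('a) * (w x)\<^sup>2" for x
  proof -
    have "(\<Sum>b\<in>Basis. grad (\<lambda>x. x \<bullet> b) x \<bullet> b) = real DIM('a)"
      by (simp add: grad_coordinate)
    moreover have "x \<bullet> grad (\<lambda>x. w x * w x) x = 2 * (w x * (grad w x \<bullet> x))"
      by (simp add: grad_mult[OF w w] inner_add_right inner_commute)
    ultimately show ?thesis
      unfolding eq[symmetric] by (simp add: power2_eq_square algebra_simps)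
  qed
  moreover have "r ^ (DIM('a) - 1) * (LINT v|sphere_measure 1. w (r *\<^sub>R v) * w (r *\<^sub>R v) * ((r *\<^sub>R v) \<bullet> v))
      = r * surface_integral r (\<lambda>x. (w x)\<^sup>2)"
  proof -
    have "(LINT v|sphere_measure 1. w (r *\<^sub>R v) * w (r *\<^sub>R v) * ((r *\<^sub>R v) \<bullet> v))
        = (LINT v|sphere_measure 1. r * (w (r *\<^sub>R v))\<^sup>2)"
      by (intro Bochner_Integration.integral_cong) (auto simp: power2_eq_square dot_square_norm)
    then show ?thesis by (simp add: surface_integral_def)
  qed
  ultimately show ?thesis by simp
qed

text \<open>The field w x has divergence \<open>g\<close> by the equation for \<open>w\<close> and
  normal component r w on the sphere.\<close>

lemma radial_potential_duality:
  fixes u :: "'a::euclidean_space \<Rightarrow> real"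
  assumes u: "continuous_on (ball 0 M) u" and du: "L2_loc (ball 0 M) du"
    and weak: "weak_gradient (ball 0 M) u du" and r: "0 < r" "r < M"
    and w: "real_polynomial_function w"
    and eq: "\<And>x. real DIM('a) * w x + grad w x \<bullet> x = g x"
  shows "(LINT x:ball 0 r|lebesgue. u x * g x + w x * (x \<bullet> du x))
     = r * surface_integral r (\<lambda>x. u x * w x)"
proof -
  have c: "real_polynomial_function (\<lambda>x. x \<bullet> b)" for b :: 'a
    by (rule real_polynomial_function_coordinate)
  have "(LINT x:ball 0 r|lebesgue. u x * (\<Sum>b\<in>Basis. grad (\<lambda>x. (w x *\<^sub>R x) \<bullet> b) x \<bullet> b)
        + (w x *\<^sub>R x) \<bullet> du x)
      = r ^ (DIM('a) - 1) * (LINT v|sphere_measure 1. u (r *\<^sub>R v) * ((w (r *\<^sub>R v) *\<^sub>R (r *\<^sub>R v)) \<bullet> v))"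
    by (rule divergence_ball_polynomial[OF u du weak r])
      (auto intro!: real_polynomial_function.intros(4) w c)
  moreover have "(\<Sum>b\<in>Basis. grad (\<lambda>x. (w x *\<^sub>R x) \<bullet> b) x \<bullet> b) = g x" for x
  proof -
    have "(\<Sum>b\<in>Basis. grad (\<lambda>x. (w x *\<^sub>R x) \<bullet> b) x \<bullet> b) = (\<Sum>b\<in>Basis. w x + (grad w x \<bullet> b) * (x \<bullet> b))"
      by (intro sum.cong) (auto simp: grad_mult[OF w c] grad_coordinate inner_add_left)
    also have "\<dots> = g x"
      unfolding eq[symmetric] by (simp add: sum.distrib euclidean_inner[of "grad w x" x])
    finally show ?thesis .
  qed
  moreover have "r ^ (DIM('a) - 1) * (LINT v|sphere_measure 1. u (r *\<^sub>R v) * ((w (r *\<^sub>R v) *\<^sub>R (r *\<^sub>R v)) \<bullet> v))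
      = r * surface_integral r (\<lambda>x. u x * w x)"
  proof -
    have "(LINT v|sphere_measure 1. u (r *\<^sub>R v) * ((w (r *\<^sub>R v) *\<^sub>R (r *\<^sub>R v)) \<bullet> v))
        = (LINT v|sphere_measure 1. r * (u (r *\<^sub>R v) * w (r *\<^sub>R v)))"
      by (intro Bochner_Integration.integral_cong) (auto simp: dot_square_norm)
    then show ?thesis by (simp add: surface_integral_def)
  qed
  ultimately show ?thesis by simp
qed

text \<open>Young's inequality; the free weight a serves to balance the terms to be
  absorbed.\<close>

lemma two_mult_le_weighted: "2 * (x * y) \<le> a * y\<^sup>2 + x\<^sup>2 / a" if "a > 0" for x y a :: real
proof -
  have "0 \<le> (a * y - x)\<^sup>2 / a" using that by simp
  also have "\<dots> = a * y\<^sup>2 + x\<^sup>2 / a - 2 * (x * y)"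
    using that by (simp add: power2_eq_square field_simps)
  finally show ?thesis by simp
qed

text \<open>The supremum of \<integral> (2 u g - g^2) over square integrable g is \<integral> u^2,
  attained at g = u, so a bound uniform in polynomials g is as good as one for \<integral> u^2. The
  potential \<open>w\<close> must disappear from it: its square on the boundary is converted into
  interior terms by the energy identity, and its square in the interior is absorbed there.\<close>

lemma poincare_dual:
  fixes u :: "'a::euclidean_space \<Rightarrow> real"
  assumes u: "continuous_on (ball 0 M) u" and du: "L2_loc (ball 0 M) du"
    and weak: "weak_gradient (ball 0 M) u du" and r: "0 < r" "r < M"
    and g: "real_polynomial_function g"
  shows "(LINT x:ball 0 r|lebesgue. 2 * (u x * g x) - (g x)\<^sup>2)
     \<le> 4 * r * surface_integral r (\<lambda>x. (u x)\<^sup>2) + 8 * r\<^sup>2 * (LINT x:ball 0 r|lebesgue. (norm (du x))\<^sup>2)"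
proof -
  let ?n = "real DIM('a)" and ?B = "ball (0::'a) r" and ?K = "cball (0::'a) r"
  have n: "?n \<ge> 1" using DIM_positive[where 'a='a] by linarith
  obtain w where w: "real_polynomial_function w" and eq: "\<And>x. ?n * w x + grad w x \<bullet> x = g x"
    using ex_radial_potential[OF g, of "DIM('a)"] by auto
  have KM: "?K \<subseteq> ball 0 M" using r by auto
  have uK: "continuous_on ?K u" using u KM by (rule continuous_on_subset)
  have uS: "continuous_on (sphere 0 r) u" using uK by (rule continuous_on_subset) auto
  have pc: "continuous_on A w" "continuous_on A g" for A
    using w g by (auto intro: continuous_on_real_polynomial_function)
  have duK: "set_integrable lebesgue ?K du" by (rule L2_loc_imp_set_integrable[OF du _ KM]) simp
  have du2: "set_integrable lebesgue ?B (\<lambda>x. (norm (du x))\<^sup>2)"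
    using du KM by (intro set_integrable_ball) (auto simp: L2_loc_def)
  have wdu: "set_integrable lebesgue ?B (\<lambda>x. w x * (x \<bullet> du x))"
    using set_integrable_ball[OF set_integrable_bilinear_continuous[OF bilinear_inner _ _ duK, of "\<lambda>x. w x *\<^sub>R x"]]
    by (simp add: continuous_intros pc)
  have ig: "set_integrable lebesgue ?B (\<lambda>x. u x * g x)"
    by (intro set_integrable_ball_continuous continuous_intros uK pc)
  have ig2: "set_integrable lebesgue ?B (\<lambda>x. (g x)\<^sup>2)"
    by (intro set_integrable_ball_continuous continuous_intros uK pc)
  have ie: "set_integrable lebesgue ?B (\<lambda>x. 2 * (w x * g x) - ?n * (w x)\<^sup>2)"
    by (intro set_integrable_ball_continuous continuous_intros pc)
  \<comment> \<open>The weight n/4 is small enough for the absorption below; the other coefficient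
    4/n is at most 4 because n \<ge> 1.\<close>
  have boundary: "2 * surface_integral r (\<lambda>x. u x * w x)
     \<le> (?n / 4) * surface_integral r (\<lambda>x. (w x)\<^sup>2) + 4 * surface_integral r (\<lambda>x. (u x)\<^sup>2)"
  proof -
    have "surface_integral r (\<lambda>x. 2 * (u x * w x))
       \<le> surface_integral r (\<lambda>x. (?n / 4) * (w x)\<^sup>2 + 4 * (u x)\<^sup>2)"
    proof (rule surface_integral_mono)
      fix x
      have "2 * (u x * w x) \<le> (?n / 4) * (w x)\<^sup>2 + (u x)\<^sup>2 / (?n / 4)"
        using n by (intro two_mult_le_weighted) simp
      also have "(u x)\<^sup>2 / (?n / 4) \<le> 4 * (u x)\<^sup>2"
        using n mult_right_mono[OF n, of "(u x)\<^sup>2"] by (simp add: field_simps)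
      finally show "2 * (u x * w x) \<le> (?n / 4) * (w x)\<^sup>2 + 4 * (u x)\<^sup>2" by simp
    qed (intro r continuous_intros uS pc)+
    also have "\<dots> = (?n / 4) * surface_integral r (\<lambda>x. (w x)\<^sup>2) + 4 * surface_integral r (\<lambda>x. (u x)\<^sup>2)"
      using r by (subst surface_integral_add)
        (auto intro!: continuous_intros uS pc simp: surface_integral_cmult simp del: times_divide_eq_left)
    finally show ?thesis by (simp add: surface_integral_cmult)
  qed
  have energy: "(LINT x:?B|lebesgue. 2 * (w x * g x) - ?n * (w x)\<^sup>2) = r * surface_integral r (\<lambda>x. (w x)\<^sup>2)"
    by (rule radial_potential_energy[OF w r(1) eq])
  have duality: "(LINT x:?B|lebesgue. u x * g x) + (LINT x:?B|lebesgue. w x * (x \<bullet> du x))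
     = r * surface_integral r (\<lambda>x. u x * w x)"
    using radial_potential_duality[OF u du weak r w eq] set_integral_add(2)[OF ig wdu] by simp
  \<comment> \<open>The energy integrand, multiplied by n/4, contributes -(n^2/4) w^2; Young's
    inequality for the gradient term spends n^2/8 of it.\<close>
  have interior: "- 2 * (LINT x:?B|lebesgue. w x * (x \<bullet> du x)) - (LINT x:?B|lebesgue. (g x)\<^sup>2)
      + (?n / 4) * (LINT x:?B|lebesgue. 2 * (w x * g x) - ?n * (w x)\<^sup>2)
     \<le> 8 * r\<^sup>2 * (LINT x:?B|lebesgue. (norm (du x))\<^sup>2)"
  proof -
    have "(LINT x:?B|lebesgue. - 2 * (w x * (x \<bullet> du x)) - (g x)\<^sup>2 + (?n / 4) * (2 * (w x * g x) - ?n * (w x)\<^sup>2))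
       \<le> (LINT x:?B|lebesgue. 8 * r\<^sup>2 * (norm (du x))\<^sup>2)"
    proof (rule set_integral_mono)
      show "set_integrable lebesgue ?B
          (\<lambda>x. - 2 * (w x * (x \<bullet> du x)) - (g x)\<^sup>2 + (?n / 4) * (2 * (w x * g x) - ?n * (w x)\<^sup>2))"
        by (intro set_integral_add(1) set_integral_diff(1) set_integrable_mult_right wdu ig2 ie)
      show "set_integrable lebesgue ?B (\<lambda>x. 8 * r\<^sup>2 * (norm (du x))\<^sup>2)"
        by (intro set_integrable_mult_right du2)
      fix x :: 'a assume x: "x \<in> ?B"
      have "\<bar>x \<bullet> du x\<bar> \<le> r * norm (du x)"
        using x Cauchy_Schwarz_ineq2[of x "du x"] mult_right_mono[of "norm x" r "norm (du x)"] by auto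
      then have sq: "(x \<bullet> du x)\<^sup>2 \<le> r\<^sup>2 * (norm (du x))\<^sup>2"
        using power_mono[of "\<bar>x \<bullet> du x\<bar>" "r * norm (du x)" 2] by (simp add: power_mult_distrib)
      have "2 * (- (x \<bullet> du x) * w x) \<le> (?n\<^sup>2 / 8) * (w x)\<^sup>2 + (- (x \<bullet> du x))\<^sup>2 / (?n\<^sup>2 / 8)"
        using n by (intro two_mult_le_weighted) simp
      also have "(- (x \<bullet> du x))\<^sup>2 / (?n\<^sup>2 / 8) \<le> 8 * (x \<bullet> du x)\<^sup>2"
        using n mult_right_mono[OF one_le_power[OF n, of 2], of "(x \<bullet> du x)\<^sup>2"]
        by (simp add: field_simps)
      finally have 1: "- 2 * (w x * (x \<bullet> du x)) \<le> (?n\<^sup>2 / 8) * (w x)\<^sup>2 + 8 * (r\<^sup>2 * (norm (du x))\<^sup>2)"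
        using sq by (simp add: mult.commute)
      \<comment> \<open>What is left after Young's inequality is exactly minus this sum of
        squares.\<close>
      have "0 \<le> (?n * w x - 2 * g x)\<^sup>2 / 8 + (g x)\<^sup>2 / 2" by simp
      then have 2: "(?n\<^sup>2 / 8) * (w x)\<^sup>2 - (g x)\<^sup>2 + (?n / 4) * (2 * (w x * g x) - ?n * (w x)\<^sup>2) \<le> 0"
        by (simp add: power2_eq_square field_simps)
      show "- 2 * (w x * (x \<bullet> du x)) - (g x)\<^sup>2 + (?n / 4) * (2 * (w x * g x) - ?n * (w x)\<^sup>2)
         \<le> 8 * r\<^sup>2 * (norm (du x))\<^sup>2"
        using 1 2 by linarith
    qed
    moreover have ia: "set_integrable lebesgue ?B (\<lambda>x. - 2 * (w x * (x \<bullet> du x)))"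
      and ib: "set_integrable lebesgue ?B (\<lambda>x. (?n / 4) * (2 * (w x * g x) - ?n * (w x)\<^sup>2))"
      by (intro set_integrable_mult_right wdu ie)+
    ultimately show ?thesis
      by (simp only: set_integral_add(2)[OF set_integral_diff(1)[OF ia ig2] ib]
          set_integral_diff(2)[OF ia ig2] set_integral_mult_right)
  qed
  have "(LINT x:?B|lebesgue. 2 * (u x * g x) - (g x)\<^sup>2)
      = 2 * (LINT x:?B|lebesgue. u x * g x) - (LINT x:?B|lebesgue. (g x)\<^sup>2)"
    using ig ig2 by (simp add: set_integral_diff(2) set_integrable_mult_right)
  moreover have "r * (2 * surface_integral r (\<lambda>x. u x * w x))
     \<le> r * ((?n / 4) * surface_integral r (\<lambda>x. (w x)\<^sup>2) + 4 * surface_integral r (\<lambda>x. (u x)\<^sup>2))"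
    using boundary r by (intro mult_left_mono) auto
  ultimately show ?thesis
    using interior duality energy by (simp add: algebra_simps)
qed

text \<open>Since 2 u g - g^2 = u^2 - (u - g)^2, a Stone-Weierstrass approximation of
  \<open>u\<close> within d loses at most d^2 times the volume of the ball.\<close>

theorem poincare_ball:
  fixes u :: "'a::euclidean_space \<Rightarrow> real"
  assumes u: "continuous_on (ball 0 M) u" and du: "L2_loc (ball 0 M) du"
    and weak: "weak_gradient (ball 0 M) u du" and r: "0 < r" "r < M"
  shows "(LINT x:ball 0 r|lebesgue. (u x)\<^sup>2)
     \<le> 4 * r * surface_integral r (\<lambda>x. (u x)\<^sup>2) + 8 * r\<^sup>2 * (LINT x:ball 0 r|lebesgue. (norm (du x))\<^sup>2)"
    (is "?I \<le> ?R")
proof (rule field_le_epsilon)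
  fix e :: real assume e: "e > 0"
  let ?B = "ball (0::'a) r" and ?K = "cball (0::'a) r"
  have uK: "continuous_on ?K u" by (rule continuous_on_subset[OF u]) (use r in auto)
  define V where "V = (LINT x:?B|lebesgue. (1::real))"
  have i1: "set_integrable lebesgue ?B (\<lambda>x. 1 :: real)"
    by (intro set_integrable_ball_continuous continuous_intros)
  have V: "V \<ge> 0" unfolding V_def set_lebesgue_integral_def by (intro integral_nonneg_AE) auto
  \<comment> \<open>Chosen so that d^2 V \<le> e; the added 1 makes the denominator positive from V
    \<ge> 0 alone.\<close>
  define d where "d = sqrt (e / (V + 1))"
  have d: "d > 0" "d\<^sup>2 * V \<le> e"
    using e V by (auto simp: d_def field_simps)
  obtain g where g: "real_polynomial_function g" "\<And>x. x \<in> ?K \<Longrightarrow> \<bar>u x - g x\<bar> < d"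
    using Stone_Weierstrass_real_polynomial_function[OF compact_cball uK d(1)] by blast
  have gc: "continuous_on ?K g" using g(1) by (rule continuous_on_real_polynomial_function)
  have ig: "set_integrable lebesgue ?B (\<lambda>x. 2 * (u x * g x) - (g x)\<^sup>2)"
    by (intro set_integrable_ball_continuous continuous_intros uK gc)
  have "?I \<le> (LINT x:?B|lebesgue. (2 * (u x * g x) - (g x)\<^sup>2) + d\<^sup>2 * 1)"
  proof (rule set_integral_mono)
    show "set_integrable lebesgue ?B (\<lambda>x. (u x)\<^sup>2)"
      by (intro set_integrable_ball_continuous continuous_intros uK)
    show "set_integrable lebesgue ?B (\<lambda>x. (2 * (u x * g x) - (g x)\<^sup>2) + d\<^sup>2 * 1)"
      by (intro set_integral_add(1) ig set_integrable_mult_right i1)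
    fix x assume "x \<in> ?B"
    then have "\<bar>u x - g x\<bar> \<le> d" using g(2)[of x] by simp
    then have "(u x - g x)\<^sup>2 \<le> d\<^sup>2" using power_mono[of "\<bar>u x - g x\<bar>" d 2] by simp
    then show "(u x)\<^sup>2 \<le> (2 * (u x * g x) - (g x)\<^sup>2) + d\<^sup>2 * 1"
      by (simp add: power2_eq_square algebra_simps)
  qed
  also have "\<dots> = (LINT x:?B|lebesgue. 2 * (u x * g x) - (g x)\<^sup>2) + d\<^sup>2 * V"
    unfolding V_def set_integral_mult_right[symmetric]
    by (intro set_integral_add(2) ig set_integrable_mult_right i1)
  also have "\<dots> \<le> ?R + e"
    using poincare_dual[OF u du weak r g(1)] d(2) by (rule add_mono)
  finally show "?I \<le> ?R + e" .
qed

section \<open>Spherical harmonics\<close>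

text \<open>Second derivatives along coordinate lines become the divergence of the gradient, the
  shape in which harmonicity enters the divergence theorem.\<close>

lemma laplacian_polynomial:
  assumes p: "real_polynomial_function p"
  shows "laplacian p x = (\<Sum>b\<in>Basis. grad (\<lambda>x. grad p x \<bullet> b) x \<bullet> b)"
proof -
  have "(deriv ^^ 2) (\<lambda>t. p (x + t *\<^sub>R b)) 0 = grad (\<lambda>x. grad p x \<bullet> b) x \<bullet> b" for b
  proof -
    have "deriv (\<lambda>t. p (x + t *\<^sub>R b)) = (\<lambda>t. grad p (x + t *\<^sub>R b) \<bullet> b)"
      by (intro ext DERIV_imp_deriv GDERIV_line GDERIV_grad p)
    moreover have "deriv (\<lambda>t. grad p (x + t *\<^sub>R b) \<bullet> b) 0 = grad (\<lambda>x. grad p x \<bullet> b) (x + 0 *\<^sub>R b) \<bullet> b"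
      by (intro DERIV_imp_deriv GDERIV_line[where f = "\<lambda>x. grad p x \<bullet> b"] GDERIV_grad
          real_polynomial_function_grad p)
    ultimately show ?thesis by (simp add: numeral_2_eq_2)
  qed
  then show ?thesis by (simp add: laplacian_def)
qed

section \<open>The inner product on the unit sphere\<close>

lemma sphere_inner_commute: "sphere_inner f g = sphere_inner g f"
  by (simp add: sphere_inner_def mult.commute)

lemma sphere_inner_cong:
  assumes "\<And>x. norm x = 1 \<Longrightarrow> f x = f' x" "\<And>x. norm x = 1 \<Longrightarrow> g x = g' x"
  shows "sphere_inner f g = sphere_inner f' g'"
  unfolding sphere_inner_def using assms by (intro Bochner_Integration.integral_cong) auto

lemma sphere_inner_self_nonneg: "0 \<le> sphere_inner f f"
  unfolding sphere_inner_def by (intro integral_nonneg_AE) auto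

lemma integrable_sphere_inner:
  fixes f g :: "'a::euclidean_space \<Rightarrow> real"
  assumes "continuous_on (sphere 0 1) f" "continuous_on (sphere 0 1) g"
  shows "integrable (sphere_measure 1) (\<lambda>x. f x * g x)"
  by (intro integrable_sphere_measure continuous_intros assms) simp

lemma sphere_inner_diff_left:
  fixes f f' g :: "'a::euclidean_space \<Rightarrow> real"
  assumes "continuous_on (sphere 0 1) f" "continuous_on (sphere 0 1) f'" "continuous_on (sphere 0 1) g"
  shows "sphere_inner (\<lambda>x. f x - f' x) g = sphere_inner f g - sphere_inner f' g"
  using assms by (simp add: sphere_inner_def left_diff_distrib integrable_sphere_inner)

lemma sphere_inner_sum_left:
  fixes f :: "'i \<Rightarrow> 'a::euclidean_space \<Rightarrow> real"
  assumes "\<And>i. i \<in> I \<Longrightarrow> continuous_on (sphere 0 1) (f i)" "continuous_on (sphere 0 1) g"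
  shows "sphere_inner (\<lambda>x. \<Sum>i\<in>I. f i x) g = (\<Sum>i\<in>I. sphere_inner (f i) g)"
  using assms by (simp add: sphere_inner_def sum_distrib_right integrable_sphere_inner)

lemma surface_integral_1: "surface_integral 1 (\<lambda>x. (u x)\<^sup>2) = sphere_inner u u"
  by (simp add: surface_integral_def sphere_inner_def power2_eq_square)

section \<open>Green's identity and orthogonality of degrees\<close>

lemma homogeneous_harmonic_polynomialD:
  assumes "homogeneous_harmonic_polynomial m p"
  shows "real_polynomial_function p" "p (c *\<^sub>R x) = c ^ m * p x" "laplacian p x = 0"
  using assms unfolding homogeneous_harmonic_polynomial_def by auto

text \<open>The field grad q is divergence free because q is harmonic, and its normal component on
  the unit sphere is m q by Euler's relation.\<close>

lemma green_harmonic: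
  fixes u :: "'a::euclidean_space \<Rightarrow> real"
  assumes u: "continuous_on (ball 0 M) u" and du: "L2_loc (ball 0 M) du"
    and weak: "weak_gradient (ball 0 M) u du" and M: "M > 1"
    and q: "homogeneous_harmonic_polynomial m q"
  shows "(LINT x:ball 0 1|lebesgue. grad q x \<bullet> du x) = real m * sphere_inner u q"
proof -
  note qD = homogeneous_harmonic_polynomialD[OF q]
  have "(LINT x:ball 0 1|lebesgue. u x * (\<Sum>b\<in>Basis. grad (\<lambda>x. grad q x \<bullet> b) x \<bullet> b) + grad q x \<bullet> du x)
      = 1 ^ (DIM('a) - 1) * (LINT w|sphere_measure 1. u (1 *\<^sub>R w) * (grad q (1 *\<^sub>R w) \<bullet> w))"
    by (rule divergence_ball_polynomial[OF u du weak]) (use M qD in \<open>auto intro: real_polynomial_function_grad\<close>)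
  then have "(LINT x:ball 0 1|lebesgue. grad q x \<bullet> du x) = (LINT w|sphere_measure 1. u w * (grad q w \<bullet> w))"
    by (simp add: laplacian_polynomial[OF qD(1), symmetric] qD(3))
  also have "(\<lambda>w. u w * (grad q w \<bullet> w)) = (\<lambda>w. real m * (u w * q w))"
    by (simp add: fun_eq_iff euler_homogeneous[OF qD(1,2)])
  finally show ?thesis by (simp add: sphere_inner_def)
qed

lemma green_harmonic_polynomial:
  assumes p: "real_polynomial_function p" and q: "homogeneous_harmonic_polynomial m q"
  shows "(LINT x:ball 0 1|lebesgue. grad q x \<bullet> grad p x) = real m * sphere_inner p q"
  by (rule green_harmonic[where M = 2])
    (auto intro!: p q continuous_on_real_polynomial_function L2_loc_grad weak_gradient_polynomial)

text \<open>The Dirichlet form of p and q is symmetric, so it equals both m and k times the same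
  inner product.\<close>

lemma harmonic_orthogonal:
  assumes p: "homogeneous_harmonic_polynomial m p" and q: "homogeneous_harmonic_polynomial k q"
    and "m \<noteq> k"
  shows "sphere_inner p q = 0"
proof -
  have "real k * sphere_inner p q = (LINT x:ball 0 1|lebesgue. grad q x \<bullet> grad p x)"
    using green_harmonic_polynomial[OF homogeneous_harmonic_polynomialD(1)[OF p] q] by simp
  also have "\<dots> = (LINT x:ball 0 1|lebesgue. grad p x \<bullet> grad q x)"
    by (simp add: inner_commute)
  also have "\<dots> = real m * sphere_inner p q"
    using green_harmonic_polynomial[OF homogeneous_harmonic_polynomialD(1)[OF q] p]
    by (simp add: sphere_inner_commute)
  finally show ?thesis using \<open>m \<noteq> k\<close> by simp
qed

lemma grad_sum:
  fixes p :: "'i \<Rightarrow> 'a::euclidean_space \<Rightarrow> real"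
  assumes "finite I" "\<And>i. i \<in> I \<Longrightarrow> real_polynomial_function (p i)"
  shows "grad (\<lambda>x. \<Sum>i\<in>I. p i x) x = (\<Sum>i\<in>I. grad (p i) x)"
  using assms
proof (induction I)
  case empty
  show ?case using grad_eqI[OF GDERIV_const] by simp
next
  case (insert i I)
  then show ?case
    by (simp add: grad_add[of "p i" "\<lambda>x. \<Sum>i\<in>I. p i x"] real_polynomial_function_sum)
qed

text \<open>This is \<open>0 \<le> \<integral> \<bar>du - grad P\<bar>\<^sup>2\<close> with \<open>P\<close> the sum of the \<open>p m\<close>.\<close>

lemma harmonic_energy_bound:
  fixes u :: "'a::euclidean_space \<Rightarrow> real"
  assumes u: "continuous_on (ball 0 M) u" and du: "L2_loc (ball 0 M) du"
    and weak: "weak_gradient (ball 0 M) u du" and M: "M > 1" and I: "finite I"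
    and p: "\<And>m. m \<in> I \<Longrightarrow> homogeneous_harmonic_polynomial m (p m)"
  shows "(\<Sum>m\<in>I. real m * (2 * sphere_inner u (p m) - sphere_inner (p m) (p m)))
    \<le> (LINT x:ball 0 1|lebesgue. (norm (du x))\<^sup>2)"
proof -
  let ?B = "ball (0::'a) 1" and ?K = "cball (0::'a) 1"
  define P where "P x = (\<Sum>m\<in>I. p m x)" for x
  note pD = homogeneous_harmonic_polynomialD[OF p]
  have P: "real_polynomial_function P"
    unfolding P_def using I pD(1) by (intro real_polynomial_function_sum) auto
  have gP: "grad P x = (\<Sum>m\<in>I. grad (p m) x)" for x
    unfolding P_def using I pD(1) by (rule grad_sum)
  have KM: "?K \<subseteq> ball 0 M" using M by auto
  have duK: "set_integrable lebesgue ?K du" by (rule L2_loc_imp_set_integrable[OF du _ KM]) simp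
  have i1: "set_integrable lebesgue ?B (\<lambda>x. grad q x \<bullet> du x)" if "real_polynomial_function q" for q
    by (intro set_integrable_ball set_integrable_bilinear_continuous[OF bilinear_inner] duK
        continuous_on_grad that compact_cball)
  have i2: "set_integrable lebesgue ?B (\<lambda>x. grad q x \<bullet> grad P x)" if "real_polynomial_function q" for q
    by (intro set_integrable_ball_continuous continuous_intros continuous_on_grad that P)
  have i3: "set_integrable lebesgue ?B (\<lambda>x. 2 * (grad q x \<bullet> du x) - grad q x \<bullet> grad P x)"
    if "real_polynomial_function q" for q
    by (intro set_integral_diff(1) set_integrable_mult_right i1 i2 that)
  \<comment> \<open>The \<open>p m\<close> are arbitrary harmonic polynomials here, not yet
    projections of \<open>u\<close>, so the pairing with \<open>u\<close> and the square stay
    separate. Of grad P only the part of degree m survives against grad (p m).\<close>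
  have "real m * (2 * sphere_inner u (p m) - sphere_inner (p m) (p m))
      = (LINT x:?B|lebesgue. 2 * (grad (p m) x \<bullet> du x) - grad (p m) x \<bullet> grad P x)" if m: "m \<in> I" for m
  proof -
    have "sphere_inner P (p m) = (\<Sum>k\<in>I. sphere_inner (p k) (p m))"
      unfolding P_def using pD(1) m
      by (intro sphere_inner_sum_left continuous_on_real_polynomial_function) auto
    also have "\<dots> = (\<Sum>k\<in>I. if k = m then sphere_inner (p m) (p m) else 0)"
      using harmonic_orthogonal[OF p p] m by (intro sum.cong) auto
    also have "\<dots> = sphere_inner (p m) (p m)" using I m by simp
    finally have "(LINT x:?B|lebesgue. grad (p m) x \<bullet> grad P x) = real m * sphere_inner (p m) (p m)"
      using green_harmonic_polynomial[OF P p[OF m]] by simp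
    moreover have "(LINT x:?B|lebesgue. grad (p m) x \<bullet> du x) = real m * sphere_inner u (p m)"
      by (rule green_harmonic[OF u du weak M p[OF m]])
    ultimately show ?thesis
      using i1[OF pD(1)[OF m]] i2[OF pD(1)[OF m]]
      by (simp add: set_integral_diff(2) set_integrable_mult_right algebra_simps)
  qed
  then have "(\<Sum>m\<in>I. real m * (2 * sphere_inner u (p m) - sphere_inner (p m) (p m)))
      = (\<Sum>m\<in>I. LINT x:?B|lebesgue. 2 * (grad (p m) x \<bullet> du x) - grad (p m) x \<bullet> grad P x)"
    by (rule sum.cong[OF refl])
  also have "\<dots> = (LINT x:?B|lebesgue. \<Sum>m\<in>I. 2 * (grad (p m) x \<bullet> du x) - grad (p m) x \<bullet> grad P x)"
    using i3[OF pD(1)] unfolding set_lebesgue_integral_def set_integrable_def scaleR_sum_right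
    by (intro Bochner_Integration.integral_sum[symmetric]) auto
  also have "\<dots> = (LINT x:?B|lebesgue. 2 * (grad P x \<bullet> du x) - grad P x \<bullet> grad P x)"
    by (simp add: gP inner_sum_left sum_subtractf sum_distrib_left)
  also have "\<dots> \<le> (LINT x:?B|lebesgue. (norm (du x))\<^sup>2)"
  proof (rule set_integral_mono[OF i3[OF P]])
    show "set_integrable lebesgue ?B (\<lambda>x. (norm (du x))\<^sup>2)"
      using du KM by (intro set_integrable_ball) (auto simp: L2_loc_def)
    fix x
    have "0 \<le> (du x - grad P x) \<bullet> (du x - grad P x)" by simp
    then show "2 * (grad P x \<bullet> du x) - grad P x \<bullet> grad P x \<le> (norm (du x))\<^sup>2"
      by (simp add: inner_diff_left inner_diff_right inner_commute power2_norm_eq_inner)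
  qed
  finally show ?thesis .
qed

text \<open>The expansion is given only as mean-square convergence, with \<open>\<Phi> m\<close>
  prescribed on the sphere, so it is exchanged for a harmonic polynomial. The partial sums have a
  fixed inner product with \<open>p m\<close> from k = m on, and convergence passes this value to
  \<open>u\<close>; the mean-square error is then the missing part of Parseval's sum.\<close>

lemma spherical_expansion_parseval:
  fixes u :: "'a::euclidean_space \<Rightarrow> real"
  assumes u: "continuous_on (sphere 0 1) u" and exp: "spherical_expansion u \<Phi>"
  obtains p where "\<And>m. homogeneous_harmonic_polynomial m (p m)"
    "\<And>m. sphere_inner u (\<Phi> m) = sphere_inner (p m) (p m)"
    "\<And>m. sphere_inner u (p m) = sphere_inner (p m) (p m)"
    "(\<lambda>k. \<Sum>m\<le>k. sphere_inner (p m) (p m)) \<longlonglongrightarrow> sphere_inner u u"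
proof -
  have "\<forall>m. \<exists>p. homogeneous_harmonic_polynomial m p \<and> (\<forall>x\<in>sphere 0 1. \<Phi> m x = p x)"
    using exp by (auto simp: spherical_expansion_def spherical_harmonics_def)
  then obtain p where "\<forall>m. homogeneous_harmonic_polynomial m (p m) \<and> (\<forall>x\<in>sphere 0 1. \<Phi> m x = p m x)"
    by (rule choice[THEN exE])
  then have p: "\<And>m. homogeneous_harmonic_polynomial m (p m)"
    and \<Phi>: "\<And>m x. norm x = 1 \<Longrightarrow> \<Phi> m x = p m x"
    by auto
  note pD = homogeneous_harmonic_polynomialD[OF p]
  have pc [continuous_intros]: "continuous_on A (p m)" for A m
    by (rule continuous_on_real_polynomial_function[OF pD(1)])
  define a where "a m = sphere_inner (p m) (p m)" for m
  define s where "s k x = (\<Sum>m\<le>k. p m x)" for k x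
  have sc: "continuous_on A (s k)" for A k unfolding s_def by (intro continuous_intros)
  define e where "e k = sphere_inner (\<lambda>x. u x - s k x) (\<lambda>x. u x - s k x)" for k
  have e: "e \<longlonglongrightarrow> 0"
  proof -
    have "e k = (LINT x|sphere_measure 1. (u x - (\<Sum>m\<le>k. \<Phi> m x))\<^sup>2)" for k
      unfolding e_def sphere_inner_def s_def
      by (intro Bochner_Integration.integral_cong) (auto simp: \<Phi> power2_eq_square)
    then have "e = (\<lambda>k. LINT x|sphere_measure 1. (u x - (\<Sum>m\<le>k. \<Phi> m x))\<^sup>2)" by blast
    then show ?thesis using exp by (simp add: spherical_expansion_def)
  qed
  have sp: "sphere_inner (s k) (p m) = (if m \<le> k then a m else 0)" for k m
  proof -
    have "sphere_inner (s k) (p m) = (\<Sum>j\<le>k. sphere_inner (p j) (p m))"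
      unfolding s_def by (intro sphere_inner_sum_left continuous_intros)
    also have "\<dots> = (\<Sum>j\<le>k. if j = m then a m else 0)"
      using harmonic_orthogonal[OF p p] by (intro sum.cong) (auto simp: a_def)
    finally show ?thesis by simp
  qed
  have d: "continuous_on (sphere 0 1) (\<lambda>x. u x - s k x)" for k by (intro continuous_intros u sc)
  have a0: "a m \<ge> 0" for m unfolding a_def by (rule sphere_inner_self_nonneg)
  have coeff: "sphere_inner u (p m) = a m" for m
  proof -
    \<comment> \<open>The two signs of \<sigma> give the two inequalities.\<close>
    have le: "\<sigma> * (sphere_inner u (p m) - a m) \<le> 0" if "\<sigma>\<^sup>2 = 1" for \<sigma> :: real
    proof (rule ccontr)
      define X where "X = \<sigma> * (sphere_inner u (p m) - a m)"
      assume "\<not> ?thesis"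
      then have X: "X > 0" by (simp add: X_def)
      \<comment> \<open>Young's inequality replaces Cauchy-Schwarz for the error. With this weight c
        * a m is at most X while e k / c tends to 0, against the lower bound 2 X; the added 1 covers
        a m = 0.\<close>
      define c where "c = X / (a m + 1)"
      have c: "c > 0" using X a0[of m] by (simp add: c_def)
      have "2 * X \<le> c * a m + e k / c" if k: "k \<ge> m" for k
      proof -
        have "X = \<sigma> * sphere_inner (\<lambda>x. u x - s k x) (p m)"
          using k by (subst sphere_inner_diff_left) (auto simp: X_def sp intro: u sc pc)
        then have "2 * X = (LINT x|sphere_measure 1. 2 * ((u x - s k x) * (\<sigma> * p m x)))"
          by (simp add: sphere_inner_def mult.left_commute)
        also have "\<dots> \<le> (LINT x|sphere_measure 1. c * (p m x * p m x)
            + ((u x - s k x) * (u x - s k x)) / c)"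
        proof (rule integral_mono)
          show "integrable (sphere_measure 1) (\<lambda>x. 2 * ((u x - s k x) * (\<sigma> * p m x)))"
            by (intro integrable_sphere_measure continuous_intros u sc) simp
          show "integrable (sphere_measure 1) (\<lambda>x. c * (p m x * p m x) + ((u x - s k x) * (u x - s k x)) / c)"
            using c by (intro integrable_sphere_measure continuous_intros u sc) auto
          show "2 * ((u x - s k x) * (\<sigma> * p m x)) \<le> c * (p m x * p m x) + ((u x - s k x) * (u x - s k x)) / c" for x
            using two_mult_le_weighted[OF c, of "u x - s k x" "\<sigma> * p m x"]
            unfolding power_mult_distrib \<open>\<sigma>\<^sup>2 = 1\<close> by (simp add: power2_eq_square)
        qed
        also have "\<dots> = c * a m + e k / c"
          unfolding a_def e_def sphere_inner_def
          by (simp add: integrable_sphere_inner pc d)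
        finally show ?thesis .
      qed
      then have "2 * X \<le> c * a m + 0 / c"
        by (intro tendsto_le[OF sequentially_bot tendsto_add[OF tendsto_const tendsto_divide[OF e tendsto_const]] tendsto_const])
          (use c in \<open>auto intro!: eventually_sequentiallyI[of m]\<close>)
      also have "c * a m + 0 / c \<le> X"
        using a0[of m] X by (simp add: c_def field_simps)
      finally show False using X by simp
    qed
    from le[of 1] le[of "- 1"] show ?thesis by simp
  qed
  have "e k = sphere_inner u u - (\<Sum>m\<le>k. a m)" for k
  proof -
    have us: "sphere_inner u (s k) = (\<Sum>m\<le>k. a m)"
    proof -
      have "sphere_inner (\<lambda>x. \<Sum>m\<le>k. p m x) u = (\<Sum>m\<le>k. sphere_inner (p m) u)"
        by (intro sphere_inner_sum_left pc u)
      also have "(\<lambda>x. \<Sum>m\<le>k. p m x) = s k" by (simp add: fun_eq_iff s_def)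
      also have "(\<Sum>m\<le>k. sphere_inner (p m) u) = (\<Sum>m\<le>k. a m)"
        by (intro sum.cong) (simp_all add: sphere_inner_commute[of "p _"] coeff)
      finally show ?thesis by (simp only: sphere_inner_commute[of u])
    qed
    have ss: "sphere_inner (s k) (s k) = (\<Sum>m\<le>k. a m)"
    proof -
      have "sphere_inner (\<lambda>x. \<Sum>m\<le>k. p m x) (s k) = (\<Sum>m\<le>k. sphere_inner (p m) (s k))"
        by (intro sphere_inner_sum_left pc sc)
      also have "(\<lambda>x. \<Sum>m\<le>k. p m x) = s k" by (simp add: fun_eq_iff s_def)
      also have "(\<Sum>m\<le>k. sphere_inner (p m) (s k)) = (\<Sum>m\<le>k. a m)"
        by (intro sum.cong) (simp_all add: sphere_inner_commute[of "p _"] sp)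
      finally show ?thesis .
    qed
    have "e k = sphere_inner u (\<lambda>x. u x - s k x) - sphere_inner (s k) (\<lambda>x. u x - s k x)"
      unfolding e_def by (rule sphere_inner_diff_left[OF u sc d])
    also have "sphere_inner u (\<lambda>x. u x - s k x) = sphere_inner u u - sphere_inner (s k) u"
      by (subst sphere_inner_commute) (rule sphere_inner_diff_left[OF u sc u])
    also have "sphere_inner (s k) (\<lambda>x. u x - s k x) = sphere_inner u (s k) - sphere_inner (s k) (s k)"
      by (subst sphere_inner_commute) (rule sphere_inner_diff_left[OF u sc sc])
    finally show ?thesis unfolding us ss sphere_inner_commute[of "s k" u] by simp
  qed
  then have "(\<lambda>k. sphere_inner u u - e k) = (\<lambda>k. \<Sum>m\<le>k. a m)" by simp
  moreover have "(\<lambda>k. sphere_inner u u - e k) \<longlonglongrightarrow> sphere_inner u u - 0"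
    by (intro tendsto_intros e)
  ultimately have "(\<lambda>k. \<Sum>m\<le>k. a m) \<longlonglongrightarrow> sphere_inner u u" by simp
  moreover have "sphere_inner u (\<Phi> m) = a m" for m
    unfolding coeff[symmetric] by (rule sphere_inner_cong) (simp_all add: \<Phi>)
  ultimately show ?thesis
    using coeff unfolding a_def by (intro that[OF p])
qed

text \<open>Every degree beyond T has weight at least T + 1 in the energy bound, so each finite part
  of the tail is at most the energy over T + 1; Parseval then allows k to tend to infinity.\<close>

lemma harmonic_tail_bound:
  fixes u :: "'a::euclidean_space \<Rightarrow> real"
  assumes u: "continuous_on (ball 0 M) u" and du: "L2_loc (ball 0 M) du"
    and weak: "weak_gradient (ball 0 M) u du" and M: "M > 1"
    and exp: "spherical_expansion u \<Phi>"
  shows "sphere_inner u u \<le> (\<Sum>m\<le>T. sphere_inner u (\<Phi> m))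
      + (LINT x:ball 0 1|lebesgue. (norm (du x))\<^sup>2) / real (Suc T)"
    and "0 \<le> sphere_inner u (\<Phi> m)"
proof -
  have uS: "continuous_on (sphere 0 1) u" by (rule continuous_on_subset[OF u]) (use M in auto)
  obtain p where p: "\<And>m. homogeneous_harmonic_polynomial m (p m)"
    and \<Phi>: "\<And>m. sphere_inner u (\<Phi> m) = sphere_inner (p m) (p m)"
    and up: "\<And>m. sphere_inner u (p m) = sphere_inner (p m) (p m)"
    and lim: "(\<lambda>k. \<Sum>m\<le>k. sphere_inner (p m) (p m)) \<longlonglongrightarrow> sphere_inner u u"
    by (rule spherical_expansion_parseval[OF uS exp], rule that)
  let ?a = "\<lambda>m. sphere_inner (p m) (p m)" and ?D = "LINT x:ball 0 1|lebesgue. (norm (du x))\<^sup>2"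
  show "0 \<le> sphere_inner u (\<Phi> m)" by (simp add: \<Phi> sphere_inner_self_nonneg)
  have "(\<Sum>m\<le>k. ?a m) \<le> (\<Sum>m\<le>T. ?a m) + ?D / real (Suc T)" if "k \<ge> T" for k
  proof -
    have "real (Suc T) * (\<Sum>m\<in>{T<..k}. ?a m) \<le> (\<Sum>m\<in>{T<..k}. real m * ?a m)"
      unfolding sum_distrib_left
      by (intro sum_mono mult_right_mono sphere_inner_self_nonneg) auto
    also have "\<dots> = (\<Sum>m\<in>{T<..k}. real m * (2 * sphere_inner u (p m) - ?a m))"
      by (simp add: up)
    also have "\<dots> \<le> ?D"
      by (rule harmonic_energy_bound[OF u du weak M]) (auto intro: p)
    finally have "(\<Sum>m\<in>{T<..k}. ?a m) \<le> ?D / real (Suc T)"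
      by (simp add: field_simps)
    moreover have "{..k} = {..T} \<union> {T<..k}" using that by auto
    then have "(\<Sum>m\<le>k. ?a m) = (\<Sum>m\<le>T. ?a m) + (\<Sum>m\<in>{T<..k}. ?a m)"
      by (simp only:) (rule sum.union_disjoint, auto)
    ultimately show ?thesis by simp
  qed
  then show "sphere_inner u u \<le> (\<Sum>m\<le>T. sphere_inner u (\<Phi> m)) + ?D / real (Suc T)"
    unfolding \<Phi> by (intro tendsto_upperbound[OF lim]) (auto intro: eventually_sequentiallyI[of T])
qed

section \<open>The frequency bound\<close>

lemma coeff_class_continuous_on:
  assumes A: "A \<in> coeff_class \<Omega> lam"
  shows "continuous_on \<Omega> A"
proof -
  have "continuous_on \<Omega> (\<lambda>x. A x $ i $ j)" for i j
  proof -
    have "C1_on \<Omega> (\<lambda>x. A x $ i $ j)" using A by (simp add: coeff_class_def)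
    then show ?thesis
      unfolding C1_on_def gderiv_def
      using has_derivative_continuous by (intro continuous_at_imp_continuous_on) blast
  qed
  then have "continuous_on \<Omega> (\<lambda>x. \<chi> i. \<chi> j. A x $ i $ j)"
    by (intro continuous_on_vec_lambda)
  then show ?thesis by simp
qed

lemma bilinear_matrix_vector_mult:
  "bilinear ((*v) :: real ^ 'n ^ 'm \<Rightarrow> real ^ 'n \<Rightarrow> real ^ 'm)"
  by (auto simp: bilinear_def linear_iff matrix_vector_mult_add_rdistrib matrix_vector_right_distrib
      matrix_vector_mult_scaleR scaleR_matrix_vector_assoc)

text \<open>The factor lam^2 comes from ellipticity used twice: the weight in \<open>freq_h\<close>
  is at most lam, and the squared gradient is at most lam times the energy density. The lower bound
  of the weight keeps the denominator of the frequency positive.\<close>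

lemma frequency_bound_energy:
  fixes u :: "real ^ 'n \<Rightarrow> real"
  assumes lam: "lam > 0" and A: "A \<in> coeff_class (ball 0 M) lam"
    and u: "continuous_on (ball 0 M) u" and du: "L2_loc (ball 0 M) du"
    and r: "0 < r" "r < M" and N: "frequency A u du r \<le> N"
    and pos: "surface_integral r (\<lambda>x. (u x)\<^sup>2) \<noteq> 0"
  shows "r * (LINT x:ball 0 r|lebesgue. (norm (du x))\<^sup>2)
    \<le> \<bar>N\<bar> * lam\<^sup>2 * surface_integral r (\<lambda>x. (u x)\<^sup>2)"
proof -
  let ?K = "cball (0 :: real ^ 'n) r" and ?S = "sphere_measure r :: (real ^ 'n) measure"
  let ?g = "surface_integral r (\<lambda>x. (u x)\<^sup>2)"
  have KM: "?K \<subseteq> ball 0 M" using r by auto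
  have SM: "sphere (0 :: real ^ 'n) r \<subseteq> ball 0 M" using r by auto
  have Ac: "continuous_on (ball 0 M) A" by (rule coeff_class_continuous_on[OF A])
  have ell: "inverse lam * (norm \<xi>)\<^sup>2 \<le> (A x *v \<xi>) \<bullet> \<xi>" "(A x *v \<xi>) \<bullet> \<xi> \<le> lam * (norm \<xi>)\<^sup>2"
    if "x \<in> ball 0 M" for x \<xi>
    using A that by (auto simp: coeff_class_def inner_commute)
  define H where "H = (LINT x|?S. freq_weight A x * \<bar>u x\<bar>\<^sup>2)"
  define D where "D = (LINT y:?K|lebesgue. (A y *v du y) \<bullet> du y)"
  have uS: "continuous_on (sphere 0 r) u" using u SM by (rule continuous_on_subset)
  have u2: "continuous_on (sphere 0 r) (\<lambda>x. (u x)\<^sup>2)" by (intro continuous_intros uS)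
  have mul: "continuous_on (sphere 0 r) (\<lambda>x. A x *v x)"
    by (rule bounded_bilinear.continuous_on[OF bilinear_conv_bounded_bilinear[THEN iffD1, OF bilinear_matrix_vector_mult]])
      (intro continuous_intros continuous_on_subset[OF Ac SM])+
  have muc: "continuous_on (sphere 0 r) (\<lambda>x. freq_weight A x * \<bar>u x\<bar>\<^sup>2)"
    unfolding freq_weight_def using r by (intro continuous_intros mul uS) auto
  have g_eq: "(LINT x|?S. (u x)\<^sup>2) = ?g"
    unfolding surface_integral_def
    by (rule integral_sphere_measure_scale[OF r(1) borel_measurable_continuous_on_restrict[OF u2]])
  have mu: "inverse lam \<le> freq_weight A x" "freq_weight A x \<le> lam" if "norm x = r" for x
    using ell[of x x] that SM r by (auto simp: freq_weight_def field_simps)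
  have iu: "integrable ?S (\<lambda>x. (u x)\<^sup>2)" and im: "integrable ?S (\<lambda>x. freq_weight A x * \<bar>u x\<bar>\<^sup>2)"
    using integrable_sphere_measure[OF r(1)] u2 muc by auto
  have "H \<le> (LINT x|?S. lam * (u x)\<^sup>2)"
    unfolding H_def using mu by (intro integral_mono im) (auto intro: iu mult_right_mono)
  then have Hle: "H \<le> lam * ?g" by (simp add: g_eq)
  have "(LINT x|?S. inverse lam * (u x)\<^sup>2) \<le> H"
    unfolding H_def using mu by (intro integral_mono im) (auto intro: iu mult_right_mono)
  then have Hge: "inverse lam * ?g \<le> H" by (simp add: g_eq)
  have "?g \<ge> 0" unfolding g_eq[symmetric] by (intro integral_nonneg_AE) auto
  then have H: "H > 0" using pos Hge lam by (smt (verit) positive_imp_inverse_positive mult_pos_pos)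
  have "frequency A u du r = r * D / H"
    using r by (simp add: frequency_def freq_D_def freq_h_def D_def H_def)
  then have "r * D = frequency A u du r * H" using H by simp
  also have "\<dots> \<le> N * H" using N H by (intro mult_right_mono) auto
  \<comment> \<open>N may be negative, while an upper bound for \<open>H\<close> can only be
    multiplied by a nonnegative number.\<close>
  also have "\<dots> \<le> \<bar>N\<bar> * (lam * ?g)"
    using Hle H by (intro mult_mono) auto
  finally have rD: "r * D \<le> \<bar>N\<bar> * (lam * ?g)" .
  have du2: "set_integrable lebesgue ?K (\<lambda>x. (norm (du x))\<^sup>2)"
    using du KM by (auto simp: L2_loc_def)
  have duK: "set_integrable lebesgue ?K du" by (rule L2_loc_imp_set_integrable[OF du _ KM]) simp
  have Adu: "set_integrable lebesgue ?K (\<lambda>x. A x *v du x)"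
    by (intro set_integrable_bilinear_continuous[OF bilinear_matrix_vector_mult] duK
        continuous_on_subset[OF Ac KM] compact_cball)
  \<comment> \<open>A product of integrable functions need not be integrable; here ellipticity
    dominates the energy density by lam times the squared gradient.\<close>
  have int: "set_integrable lebesgue ?K (\<lambda>x. (A x *v du x) \<bullet> du x)"
  proof (rule set_integrable_bound)
    show "set_integrable lebesgue ?K (\<lambda>x. lam * (norm (du x))\<^sup>2)"
      by (intro set_integrable_mult_right du2)
    have "(\<lambda>x. (indicator ?K x *\<^sub>R (A x *v du x)) \<bullet> (indicator ?K x *\<^sub>R du x)) \<in> borel_measurable lebesgue"
      using Adu duK unfolding set_integrable_def by (intro borel_measurable_inner) auto
    moreover have "(\<lambda>x. (indicator ?K x *\<^sub>R (A x *v du x)) \<bullet> (indicator ?K x *\<^sub>R du x))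
        = (\<lambda>x. indicator ?K x *\<^sub>R ((A x *v du x) \<bullet> du x))"
      by (auto simp: indicator_def)
    ultimately show "set_borel_measurable lebesgue ?K (\<lambda>x. (A x *v du x) \<bullet> du x)"
      by (simp add: set_borel_measurable_def)
    have "\<bar>(A x *v du x) \<bullet> du x\<bar> \<le> \<bar>lam * (norm (du x))\<^sup>2\<bar>" if "x \<in> ?K" for x
    proof -
      have "0 \<le> inverse lam * (norm (du x))\<^sup>2" using lam by simp
      then show ?thesis using ell[of x "du x"] that KM by fastforce
    qed
    then show "AE x in lebesgue. x \<in> ?K \<longrightarrow> norm ((A x *v du x) \<bullet> du x) \<le> norm (lam * (norm (du x))\<^sup>2)"
      by auto
  qed
  have "(LINT x:?K|lebesgue. inverse lam * (norm (du x))\<^sup>2) \<le> D"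
    unfolding D_def using ell(1) KM
    by (intro set_integral_mono int set_integrable_mult_right du2) auto
  then have "(LINT x:?K|lebesgue. (norm (du x))\<^sup>2) \<le> lam * D"
    using lam by (simp add: field_simps)
  moreover have "(LINT x:ball 0 r|lebesgue. (norm (du x))\<^sup>2) \<le> (LINT x:?K|lebesgue. (norm (du x))\<^sup>2)"
    using du2 by (intro set_integral_mono_set) auto
  ultimately have "r * (LINT x:ball 0 r|lebesgue. (norm (du x))\<^sup>2) \<le> r * (lam * D)"
    using r by (intro mult_left_mono) auto
  also have "\<dots> = lam * (r * D)" by simp
  also have "\<dots> \<le> lam * (\<bar>N\<bar> * (lam * ?g))" using rD lam by (intro mult_left_mono) auto
  finally show ?thesis by (simp add: power2_eq_square mult_ac)
qed

text \<open>
  Where \<open>g\<close> vanishes the frequency is \<open>0\<close> by the convention \<open>x / 0 = 0\<close> and carries no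
  information. The bound at such a radius is recovered by letting \<open>r\<close> increase to the first
  zero of \<open>g\<close>.
\<close>

lemma vanishing_if_zero_at_1:
  fixes g :: "real \<Rightarrow> real"
  assumes g: "continuous_on {0..1} g" "\<And>r. r \<in> {0..1} \<Longrightarrow> 0 \<le> g r" and g1: "g 1 = 0"
    and le: "\<And>s r. 0 < s \<Longrightarrow> s < r \<Longrightarrow> r \<le> 1 \<Longrightarrow> g r \<noteq> 0 \<Longrightarrow> integral {0..s} g \<le> K * g r"
  shows "integral {0..1} g = 0"
proof -
  have zero: "g s = 0" if s: "s \<in> {0<..1}" for s
  proof (rule ccontr)
    assume gs: "g s \<noteq> 0"
    \<comment> \<open>The zeros of g from s on, a nonempty set because g 1 = 0. The least one, z,
      exceeds s; strictly between s and z the assumed bound is available, and continuity carries it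
      to z, where its right-hand side is 0.\<close>
    define Z where "Z = {s..1} \<inter> g -` {0}"
    have gsub: "continuous_on {a..b} g" if "0 \<le> a" "b \<le> 1" for a b
      using g(1) by (rule continuous_on_subset) (use that in auto)
    have "closed Z" unfolding Z_def
      by (rule continuous_closed_preimage) (use s gsub in auto)
    then have "compact ({s..1} \<inter> Z)" by (intro compact_Int_closed) auto
    moreover have "{s..1} \<inter> Z = Z" by (auto simp: Z_def)
    moreover have "Z \<noteq> {}" using g1 s by (auto simp: Z_def)
    ultimately obtain z where z: "z \<in> Z" "\<And>y. y \<in> Z \<Longrightarrow> z \<le> y"
      using compact_attains_inf[of Z] by auto
    have sz: "s < z" "z \<le> 1" "g z = 0" using z gs by (auto simp: Z_def order_less_le)
    have "integral {0..s} g \<le> K * g z"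
    proof (rule continuous_ge_on_closure[where f = "\<lambda>r. K * g r"])
      show "continuous_on (closure {s<..<z}) (\<lambda>r. K * g r)"
        using sz s by (simp add: closure_greaterThanLessThan) (intro continuous_intros gsub, auto)
      show "z \<in> closure {s<..<z}" using sz by (simp add: closure_greaterThanLessThan)
      fix r assume r: "r \<in> {s<..<z}"
      have "g r \<noteq> 0"
      proof
        assume "g r = 0"
        then have "r \<in> Z" using r sz by (auto simp: Z_def)
        then show False using z(2) r by force
      qed
      then show "integral {0..s} g \<le> K * g r" using r sz s by (intro le) auto
    qed
    then have "integral {0..s} g \<le> 0" using sz by simp
    moreover have "0 \<le> integral {0..s} g"
    proof (rule Henstock_Kurzweil_Integration.integral_nonneg)
      show "g integrable_on {0..s}" using s by (intro integrable_continuous_interval gsub) auto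
      show "0 \<le> g x" if "x \<in> {0..s}" for x using that s by (intro g(2)) auto
    qed
    ultimately have "integral {0..s} g = 0" by simp
    moreover have "(integral {0..s} g = 0) = (\<forall>x\<in>{0..s}. g x = 0)"
      by (rule integral_eq_0_iff) (use s in \<open>auto intro: gsub g(2)\<close>)
    ultimately have "\<forall>x\<in>{0..s}. g x = 0" by simp
    then show False using gs s by auto
  qed
  \<comment> \<open>The argument does not reach the point 0, which does not affect the
    integral.\<close>
  have "integral {0..1} g = integral {0..1} (\<lambda>_ :: real. 0 :: real)"
    by (rule Henstock_Kurzweil_Integration.integral_spike[where S = "{0}"]) (auto simp: zero)
  then show ?thesis by simp
qed

theorem theorem1p10:
  fixes lam :: real
  assumes "lam > 0"
  shows "\<exists>M0::real. \<forall>M\<ge>M0. \<forall>N::real. \<exists>(T::nat) (C::real).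
    \<forall>(A :: real ^ 'n \<Rightarrow> real ^ 'n ^ 'n) (u :: real ^ 'n \<Rightarrow> real)
       (du :: real ^ 'n \<Rightarrow> real ^ 'n) (\<Phi> :: nat \<Rightarrow> real ^ 'n \<Rightarrow> real).
      A \<in> coeff_class (ball 0 M) lam \<longrightarrow>
      div_form_solution (ball 0 M) A u du \<longrightarrow>
      (\<exists>x\<in>ball 0 M. u x \<noteq> 0) \<longrightarrow>
      (\<forall>r. 0 < r \<and> r < M \<longrightarrow> frequency A u du r \<le> N) \<longrightarrow>
      spherical_expansion u \<Phi> \<longrightarrow>
      (LINT x:cball 0 (1/4)|lebesgue. \<bar>u x\<bar>\<^sup>2) \<le> C * (\<Sum>m\<le>T. sphere_inner u (\<Phi> m))"
proof (rule exI[of _ 2], intro allI impI)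
  \<comment> \<open>The threshold 2 puts the closed unit ball strictly inside the domain.\<close>
  fix M N :: real assume M: "M \<ge> 2"
  \<comment> \<open>\<open>L\<close> is the constant of \<open>frequency_bound_energy\<close>.
    \<open>T\<close> satisfies 2 L \<le> T + 1, so the tail is at most half of the boundary mass,
    and \<open>K\<close> collects the constants 4 and 8 of \<open>poincare_ball\<close>. The factor
    2 in C = 2 K is the price of absorbing the tail.\<close>
  define L where "L = \<bar>N\<bar> * lam\<^sup>2"
  define T where "T = nat \<lceil>2 * L\<rceil>"
  define K where "K = 4 + 8 * L"
  have L: "L \<ge> 0" by (simp add: L_def)
  have T: "2 * L \<le> real (Suc T)" unfolding T_def by linarith
  have main: "(LINT x:cball 0 (1/4)|lebesgue. \<bar>u x\<bar>\<^sup>2) \<le> 2 * K * (\<Sum>m\<le>T. sphere_inner u (\<Phi> m))"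
    if A: "A \<in> coeff_class (ball 0 M) lam" and sol: "div_form_solution (ball 0 M) A u du"
      and freq: "\<forall>r. 0 < r \<and> r < M \<longrightarrow> frequency A u du r \<le> N"
      and exp: "spherical_expansion u \<Phi>"
    for A :: "real ^ 'n \<Rightarrow> real ^ 'n ^ 'n" and u :: "real ^ 'n \<Rightarrow> real"
      and du :: "real ^ 'n \<Rightarrow> real ^ 'n" and \<Phi> :: "nat \<Rightarrow> real ^ 'n \<Rightarrow> real"
  proof -
    have u: "continuous_on (ball 0 M) u" and du: "L2_loc (ball 0 M) du"
      and weak: "weak_gradient (ball 0 M) u du"
      using sol by (auto simp: div_form_solution_def)
    have M1: "M > 1" using M by simp
    let ?g = "\<lambda>r. surface_integral r (\<lambda>x. (u x)\<^sup>2)"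
    let ?D = "\<lambda>r. LINT x:ball 0 r|lebesgue. (norm (du x))\<^sup>2"
    have g0: "0 \<le> ?g r" if "r \<ge> 0" for r
      using that unfolding surface_integral_def
      by (intro mult_nonneg_nonneg integral_nonneg_AE) auto
    have uK: "continuous_on (cball 0 r) u" if "r \<le> 1" for r
      using u by (rule continuous_on_subset) (use that M in auto)
    have iu: "set_integrable lebesgue (cball 0 r) (\<lambda>x. (u x)\<^sup>2)" if "r \<le> 1" for r
      by (intro set_integrable_continuous_compact continuous_intros uK that compact_cball)
    have energy: "r * ?D r \<le> L * ?g r" if "0 < r" "r \<le> 1" "?g r \<noteq> 0" for r
      unfolding L_def using that M freq
      by (intro frequency_bound_energy[OF assms A u du]) auto
    have interior: "(LINT x:ball 0 r|lebesgue. (u x)\<^sup>2) \<le> K * ?g r"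
      if r: "0 < r" "r \<le> 1" "?g r \<noteq> 0" for r
    proof -
      have "(LINT x:ball 0 r|lebesgue. (u x)\<^sup>2) \<le> 4 * r * ?g r + 8 * r\<^sup>2 * ?D r"
        by (rule poincare_ball[OF u du weak]) (use r M in auto)
      \<comment> \<open>One of the two powers of r is spent on the energy bound, which controls r
        times the gradient integral.\<close>
      also have "8 * r\<^sup>2 * ?D r \<le> 8 * r * (L * ?g r)"
        using energy[OF r] r by (simp add: power2_eq_square mult.assoc mult_left_mono)
      also have "4 * r * ?g r + 8 * r * (L * ?g r) = r * (K * ?g r)"
        by (simp add: K_def algebra_simps)
      also have "\<dots> \<le> 1 * (K * ?g r)"
        using r g0[of r] L by (intro mult_right_mono) (auto simp: K_def)
      finally show ?thesis by simp
    qed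
    have mass: "(LINT x:cball 0 r|lebesgue. (u x)\<^sup>2) = integral {0..r} ?g"
      and gc: "continuous_on {0..r} ?g" if "0 < r" "r \<le> 1" for r
    proof -
      have c: "continuous_on (cball 0 r) (\<lambda>x. (u x)\<^sup>2)"
        by (intro continuous_intros uK that)
      show "(LINT x:cball 0 r|lebesgue. (u x)\<^sup>2) = integral {0..r} ?g"
        using integral_radial_weight(1)[OF c, of "\<lambda>_. 1"] that by (simp add: surface_integral_def)
      show "continuous_on {0..r} ?g"
        unfolding surface_integral_def
        by (intro continuous_intros integral_radial_weight(2)[OF c continuous_on_const[where c = 1] that(1)])
    qed
    have nonneg: "0 \<le> (\<Sum>m\<le>T. sphere_inner u (\<Phi> m))"
      by (intro sum_nonneg harmonic_tail_bound(2)[OF u du weak M1 exp])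
    show ?thesis
    proof (cases "?g 1 = 0")
      \<comment> \<open>Here \<open>u\<close> vanishes almost everywhere on the unit sphere, so no
        constant C can help: the mass inside has to be exactly 0.\<close>
      case True
      have "integral {0..1} ?g = 0"
      proof (rule vanishing_if_zero_at_1[where K = K])
        fix s r :: real assume r: "0 < s" "s < r" "r \<le> 1" "?g r \<noteq> 0"
        have "integral {0..s} ?g = (LINT x:cball 0 s|lebesgue. (u x)\<^sup>2)"
          using r by (intro mass[symmetric]) auto
        \<comment> \<open>The strict gap s < r fits the closed ball into the open one.\<close>
        also have "\<dots> \<le> (LINT x:ball 0 r|lebesgue. (u x)\<^sup>2)"
          using r by (intro set_integral_mono_set set_integrable_ball iu) auto
        also have "\<dots> \<le> K * ?g r" using r by (intro interior) auto
        finally show "integral {0..s} ?g \<le> K * ?g r" .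
      qed (use True g0 gc in auto)
      then have "(LINT x:cball 0 1|lebesgue. (u x)\<^sup>2) = 0" by (simp add: mass)
      moreover have "(LINT x:cball 0 (1/4)|lebesgue. (u x)\<^sup>2) \<le> (LINT x:cball 0 1|lebesgue. (u x)\<^sup>2)"
        by (intro set_integral_mono_set iu) auto
      moreover have "0 \<le> 2 * K * (\<Sum>m\<le>T. sphere_inner u (\<Phi> m))"
        using nonneg L by (simp add: K_def)
      ultimately show ?thesis by simp
    next
      case False
      have "?g 1 \<le> (\<Sum>m\<le>T. sphere_inner u (\<Phi> m)) + ?D 1 / real (Suc T)"
        using harmonic_tail_bound(1)[OF u du weak M1 exp] by (simp add: surface_integral_1)
      \<comment> \<open>Absorption: the tail returns to the left-hand side with factor 1/2.\<close>
      also have "?D 1 / real (Suc T) \<le> ?g 1 / 2"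
      proof -
        have "2 * ?D 1 \<le> 2 * L * ?g 1" using energy[of 1] False by simp
        also have "\<dots> \<le> real (Suc T) * ?g 1" using T g0[of 1] by (intro mult_right_mono) auto
        finally show ?thesis by (simp add: field_simps)
      qed
      finally have g: "?g 1 \<le> 2 * (\<Sum>m\<le>T. sphere_inner u (\<Phi> m))" by simp
      have "(LINT x:cball 0 (1/4)|lebesgue. (u x)\<^sup>2) \<le> (LINT x:ball 0 1|lebesgue. (u x)\<^sup>2)"
        by (intro set_integral_mono_set set_integrable_ball iu) auto
      also have "\<dots> \<le> K * ?g 1" using False by (intro interior) auto
      also have "\<dots> \<le> K * (2 * (\<Sum>m\<le>T. sphere_inner u (\<Phi> m)))"
        using g L by (intro mult_left_mono) (auto simp: K_def)
      finally show ?thesis by (simp add: mult_ac)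
    qed
  qed
  show "\<exists>(T::nat) (C::real).
    \<forall>(A :: real ^ 'n \<Rightarrow> real ^ 'n ^ 'n) (u :: real ^ 'n \<Rightarrow> real)
       (du :: real ^ 'n \<Rightarrow> real ^ 'n) (\<Phi> :: nat \<Rightarrow> real ^ 'n \<Rightarrow> real).
      A \<in> coeff_class (ball 0 M) lam \<longrightarrow>
      div_form_solution (ball 0 M) A u du \<longrightarrow>
      (\<exists>x\<in>ball 0 M. u x \<noteq> 0) \<longrightarrow>
      (\<forall>r. 0 < r \<and> r < M \<longrightarrow> frequency A u du r \<le> N) \<longrightarrow>
      spherical_expansion u \<Phi> \<longrightarrow>
      (LINT x:cball 0 (1/4)|lebesgue. \<bar>u x\<bar>\<^sup>2) \<le> C * (\<Sum>m\<le>T. sphere_inner u (\<Phi> m))"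
    by (rule exI[of _ T], rule exI[of _ "2 * K"], intro allI impI, rule main)
qed

end
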